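(* Let $\mathfrak{F}\subset B(\mathcal{X})$ satisfy $\{f\in L_b(\mathcal{X}):\|f\|_\infty\le1\}\subset\mathfrak{F}$ and Hypothesis $(\mathbf{H_2})$. Then the following are equivalent: (i) $\Phi$ is uniformly asymptotically stable with respect to $\mathfrak{F}$; (ii) $\Phi$ is uniformly eventually continuous with respect to $\mathfrak{F}$ on $\mathcal{X}$, and there exists $z\in\mathcal{X}$ such that $\Phi$ satisfies $(\mathcal{C}_1)$ at $z$; (iii) there exists $z\in\mathcal{X}$ such that $\Phi$ is uniformly eventually continuous with respect to $\mathfrak{F}$ at $z$ and satisfies $(\mathcal{C}_1)$ at $z$.
   Context: Standing setting: $(\mathcal{X},\rho)$ is a Polish space; $\Phi=\{\Phi_t\}_{t\ge0}$ is a càdlàg Feller Markov process on $\mathcal{X}$ (hence strong Markov), realized as a Markov family with laws $\mathbb{P}^x$, expectations $\mathbb{E}^x$, and transition kernels $P_t(x,\cdot)$. $B(\mathcal{X})$: Borel real functions; $L_b(\mathcal X)$: bounded Lipschitz functions; $B(z,r)$: open ball; $\langle f,\mu\rangle=\int f\,d\mu$. $\mathcal{A}=\{f\in B(\mathcal{X}):\int|f|\,dP_t(x,\cdot)<\infty\ \forall x,t\}$, $P_tf(x)=\int f\,dP_t(x,\cdot)$ for $f\in\mathcal A$. Invariant measure: $\int P_t(x,\cdot)\mu(dx)=\mu$ for all $t$. Definitions: $\Phi$ is uniformly asymptotically stable with respect to $\mathfrak F$ if it has a unique invariant probability measure $\mu$, $\mathfrak F\subset L^1(\mu)$, and $\lim_{t\to\infty}\sup_{f\in\mathfrak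 F}|P_tf(x)-\langle f,\mu\rangle|=0$ for all $x$. $(\mathcal C_1)$ at $z$: for every $r>0$, $\inf_{x\in\mathcal X}\liminf_{t\to\infty}P_t(x,B(z,r))>0$. For $\mathfrak F\subset\mathcal A$, $\Phi$ is uniformly eventually continuous with respect to $\mathfrak F$ at $x$ if $\limsup_{x'\to x}\limsup_{t\to\infty}\sup_{f\in\mathfrak F}|P_tf(x')-P_tf(x)|=0$; "on $\mathcal X$" means at every point. Uniform integrability of $\{\xi_t\}$: $\lim_{K\to\infty}\sup_t\mathbb E(|\xi_t|\chi_{\{|\xi_t|\ge K\}})=0$. Hypothesis $(\mathbf{H_2})$: there is $V\in\mathcal A$ with $|f(x)|\le V(x)$ for all $f\in\mathfrak F$, $x\in\mathcal X$, such that $\{V(\Phi_t)\}_{t\ge0}$ is uniformly integrable under $\mathbb P^x$ for every $x$. *)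

theory Defs
  imports "HOL-Probability.Probability"
begin

text \<open>The process is a Markov family: a measurable space M of outcomes, laws Px x
 (one for each starting point x), and the coordinate process X t.\<close>

definition trans_kernel :: "('a::topological_space \<Rightarrow> 'w measure) \<Rightarrow> (real \<Rightarrow> 'w \<Rightarrow> 'a) \<Rightarrow> real \<Rightarrow> 'a \<Rightarrow> 'a measure" where
  "trans_kernel Px X t x = distr (Px x) borel (X t)"

definition Pt :: "('a::topological_space \<Rightarrow> 'w measure) \<Rightarrow> (real \<Rightarrow> 'w \<Rightarrow> 'a) \<Rightarrow> real \<Rightarrow> ('a \<Rightarrow> real) \<Rightarrow> 'a \<Rightarrow> real" where
  "Pt Px X t f x = (\<integral>y. f y \<partial>trans_kernel Px X t x)"

definition nat_filt :: "'w measure \<Rightarrow> (real \<Rightarrow> 'w \<Rightarrow> 'a::topological_space) \<Rightarrow> real \<Rightarrow> 'w measure" where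
  "nat_filt M X s = sigma (space M) {X r -` A \<inter> space M | r A. r \<in> {0..s} \<and> A \<in> sets borel}"

definition markov_family :: "'w measure \<Rightarrow> ('a::topological_space \<Rightarrow> 'w measure) \<Rightarrow> (real \<Rightarrow> 'w \<Rightarrow> 'a) \<Rightarrow> bool" where
  "markov_family M Px X \<longleftrightarrow>
     (\<forall>x. prob_space (Px x) \<and> sets (Px x) = sets M) \<and>
     (\<forall>t\<ge>0. X t \<in> M \<rightarrow>\<^sub>M borel) \<and>
     (\<forall>x. AE \<omega> in Px x. X 0 \<omega> = x) \<and>
     (\<forall>t\<ge>0. \<forall>B\<in>sets borel. (\<lambda>x. measure (Px x) (X t -` B \<inter> space M)) \<in> borel_measurable borel) \<and>
     (\<forall>x s t f g. 0 \<le> s \<longrightarrow> 0 \<le> t \<longrightarrow> f \<in> borel_measurable borel \<longrightarrow> bounded (range f) \<longrightarrow>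
        g \<in> borel_measurable (nat_filt M X s) \<longrightarrow> bounded (range g) \<longrightarrow>
        (\<integral>\<omega>. g \<omega> * f (X (s + t) \<omega>) \<partial>Px x) = (\<integral>\<omega>. g \<omega> * Pt Px X t f (X s \<omega>) \<partial>Px x))"

definition cadlag_paths :: "'w measure \<Rightarrow> (real \<Rightarrow> 'w \<Rightarrow> 'a::topological_space) \<Rightarrow> bool" where
  "cadlag_paths M X \<longleftrightarrow>
     (\<forall>\<omega>\<in>space M. \<forall>t\<ge>0. ((\<lambda>s. X s \<omega>) \<longlongrightarrow> X t \<omega>) (at_right t) \<and>
        (t > 0 \<longrightarrow> (\<exists>l. ((\<lambda>s. X s \<omega>) \<longlongrightarrow> l) (at_left t))))"

definition feller :: "('a::topological_space \<Rightarrow> 'w measure) \<Rightarrow> (real \<Rightarrow> 'w \<Rightarrow> 'a) \<Rightarrow> bool" where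
  "feller Px X \<longleftrightarrow>
     (\<forall>t\<ge>0. \<forall>f::'a \<Rightarrow> real. continuous_on UNIV f \<and> bounded (range f) \<longrightarrow>
        continuous_on UNIV (Pt Px X t f))"

definition cadlag_feller_markov :: "'w measure \<Rightarrow> ('a::topological_space \<Rightarrow> 'w measure) \<Rightarrow> (real \<Rightarrow> 'w \<Rightarrow> 'a) \<Rightarrow> bool" where
  "cadlag_feller_markov M Px X \<longleftrightarrow> markov_family M Px X \<and> cadlag_paths M X \<and> feller Px X"

definition classA :: "('a::topological_space \<Rightarrow> 'w measure) \<Rightarrow> (real \<Rightarrow> 'w \<Rightarrow> 'a) \<Rightarrow> ('a \<Rightarrow> real) set" where
  "classA Px X = {f. f \<in> borel_measurable borel \<and> (\<forall>x. \<forall>t\<ge>0. integrable (trans_kernel Px X t x) f)}"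

definition bounded_lipschitz :: "('a::metric_space \<Rightarrow> real) set" where
  "bounded_lipschitz = {f. bounded (range f) \<and> (\<exists>L. \<forall>x y. \<bar>f x - f y\<bar> \<le> L * dist x y)}"

definition invariant_measure :: "('a::topological_space \<Rightarrow> 'w measure) \<Rightarrow> (real \<Rightarrow> 'w \<Rightarrow> 'a) \<Rightarrow> 'a measure \<Rightarrow> bool" where
  "invariant_measure Px X \<mu> \<longleftrightarrow> sets \<mu> = sets borel \<and>
     (\<forall>t\<ge>0. \<forall>A\<in>sets borel. (\<integral>\<^sup>+x. emeasure (trans_kernel Px X t x) A \<partial>\<mu>) = emeasure \<mu> A)"

definition invariant_prob :: "('a::topological_space \<Rightarrow> 'w measure) \<Rightarrow> (real \<Rightarrow> 'w \<Rightarrow> 'a) \<Rightarrow> 'a measure \<Rightarrow> bool" where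
  "invariant_prob Px X \<mu> \<longleftrightarrow> prob_space \<mu> \<and> invariant_measure Px X \<mu>"

definition unif_asymp_stable :: "('a::topological_space \<Rightarrow> 'w measure) \<Rightarrow> (real \<Rightarrow> 'w \<Rightarrow> 'a) \<Rightarrow> ('a \<Rightarrow> real) set \<Rightarrow> bool" where
  "unif_asymp_stable Px X F \<longleftrightarrow>
     (\<exists>!\<mu>. invariant_prob Px X \<mu>) \<and>
     (\<forall>\<mu>. invariant_prob Px X \<mu> \<longrightarrow>
        (\<forall>f\<in>F. integrable \<mu> f) \<and>
        (\<forall>x. \<forall>\<epsilon>>0. eventually (\<lambda>t. \<forall>f\<in>F. \<bar>Pt Px X t f x - (\<integral>y. f y \<partial>\<mu>)\<bar> \<le> \<epsilon>) at_top))"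

definition cond_C1 :: "('a::metric_space \<Rightarrow> 'w measure) \<Rightarrow> (real \<Rightarrow> 'w \<Rightarrow> 'a) \<Rightarrow> 'a \<Rightarrow> bool" where
  "cond_C1 Px X z \<longleftrightarrow>
     (\<forall>r>0. (INF x. Liminf at_top (\<lambda>t. emeasure (trans_kernel Px X t x) (ball z r))) > 0)"

definition unif_ev_cont :: "('a::metric_space \<Rightarrow> 'w measure) \<Rightarrow> (real \<Rightarrow> 'w \<Rightarrow> 'a) \<Rightarrow> ('a \<Rightarrow> real) set \<Rightarrow> 'a \<Rightarrow> bool" where
  "unif_ev_cont Px X F x \<longleftrightarrow> F \<subseteq> classA Px X \<and>
     (\<forall>\<epsilon>>0. \<exists>\<delta>>0. \<forall>x'. dist x' x < \<delta> \<longrightarrow>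
        Limsup at_top (\<lambda>t. SUP f\<in>F. ereal \<bar>Pt Px X t f x' - Pt Px X t f x\<bar>) \<le> ereal \<epsilon>)"

definition hyp_H2 :: "'w measure \<Rightarrow> ('a::topological_space \<Rightarrow> 'w measure) \<Rightarrow> (real \<Rightarrow> 'w \<Rightarrow> 'a) \<Rightarrow> ('a \<Rightarrow> real) set \<Rightarrow> bool" where
  "hyp_H2 M Px X F \<longleftrightarrow>
     (\<exists>V\<in>classA Px X. (\<forall>f\<in>F. \<forall>x. \<bar>f x\<bar> \<le> V x) \<and>
        (\<forall>x. ((\<lambda>K. SUP t\<in>{0..}. \<integral>\<^sup>+\<omega>. ennreal (\<bar>V (X t \<omega>)\<bar> *
              indicator {\<omega>\<in>space M. K \<le> \<bar>V (X t \<omega>)\<bar>} \<omega>) \<partial>Px x) \<longlongrightarrow> 0) at_top))"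

end

theory Submission
  imports Defs
begin

text \<open>
  The test functions of \<open>\<FF>\<close> include all Lipschitz functions bounded by 1, whatever their
  Lipschitz constant, so eventual continuity at \<open>z\<close> is eventual continuity in total
  variation. Let the laws started in a ball around \<open>z\<close> merge up to \<open>\<epsilon>\<close>, and let
  \<open>\<beta>\<close> be smaller than the mass that every law eventually puts on this ball. At a late
  time each of two given laws has a part of mass \<open>\<beta>\<close> in the ball; these parts merge up to
  \<open>2\<epsilon>\<close>, and the argument is repeated with the remainders, of mass
  \<open>1 - \<beta>\<close>. Hence any two laws merge in total variation.

  For the existence of an invariant measure, take a cluster point of \<open>P\<^sub>t(z, \<cdot>)\<close>
  in the compact space of set functions with values in \<open>[0,1]\<close>. It is finitely additive, and
  invariant because laws merge, so that its countably additive part is an invariant measure.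
  That this part is not zero follows from Baire's theorem: since \<open>x \<mapsto> P\<^sub>t f(x)\<close> is
  continuous, the time at which the law from \<open>x\<close> has merged with the law from \<open>z\<close> is bounded on
  some ball that is charged by the process from \<open>z\<close>.

  Total variation handles the bounded test functions, and uniform integrability of
  \<open>V(\<Phi>\<^sub>t)\<close> reduces all of \<open>\<FF>\<close> to these by truncation. Conversely, every point of the
  support of the invariant measure satisfies the lower bound condition.
\<close>

section \<open>Total variation and Lipschitz test functions\<close>

text \<open>If \<open>P\<close> failed at arbitrarily late times, it would fail along a sequence of
  times with \<open>T n \<ge> n\<close>. One good time on each such sequence therefore suffices,
  which makes dominated convergence for sequences usable as time tends to infinity.\<close>

lemma eventually_at_top_if_sequentially:
  fixes P :: "real \<Rightarrow> bool"
  assumes "\<And>T. (\<And>n::nat. T n \<ge> real n) \<Longrightarrow> \<exists>n. P (T n)"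
  shows "eventually P at_top"
proof (rule ccontr)
  assume "\<not> eventually P at_top"
  then have "\<forall>n::nat. \<exists>t\<ge>real n. \<not> P t"
    by (auto simp: eventually_at_top_linorder)
  then obtain T where "\<And>n::nat. T n \<ge> real n \<and> \<not> P (T n)" by metis
  then show False using assms[of T] by blast
qed

lemma eventually_at_top_shiftD:
  fixes P :: "real \<Rightarrow> bool"
  assumes "eventually (\<lambda>t. P (t + u)) at_top"
  shows "eventually P at_top"
proof -
  obtain t0 where t0: "\<And>t. t \<ge> t0 \<Longrightarrow> P (t + u)"
    using assms by (auto simp: eventually_at_top_linorder)
  show ?thesis
    unfolding eventually_at_top_linorder using t0[of "t - u" for t] by (intro exI[of _ "t0 + u"]) auto
qed

lemma filterlim_real_seq_at_top:
  fixes T :: "nat \<Rightarrow> real"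
  assumes "\<And>n. T n \<ge> real n"
  shows "filterlim T at_top sequentially"
  using assms by (intro filterlim_at_top_mono[OF filterlim_real_sequentially]) auto

text \<open>The functions \<open>f n\<close> need not converge, but \<open>max (f n x) c\<close>
  tends to \<open>c\<close> almost everywhere and is dominated by \<open>1 + c\<close>, so dominated
  convergence applies to it.\<close>

lemma (in prob_space) integral_le_of_eventually_le:
  fixes f :: "nat \<Rightarrow> 'a \<Rightarrow> real"
  assumes [measurable]: "\<And>n. f n \<in> borel_measurable M"
    and bound: "\<And>n x. x \<in> space M \<Longrightarrow> \<bar>f n x\<bar> \<le> 1"
    and c: "0 \<le> c" "AE x in M. eventually (\<lambda>n. f n x \<le> c) sequentially"
    and "\<eta> > 0"
  shows "eventually (\<lambda>n. (\<integral>x. f n x \<partial>M) \<le> c + \<eta>) sequentially"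
proof -
  have "(\<lambda>n. \<integral>x. max (f n x) c \<partial>M) \<longlonglongrightarrow> (\<integral>x. c \<partial>M)"
  proof (rule integral_dominated_convergence[where w="\<lambda>_. 1 + c"])
    show "AE x in M. (\<lambda>n. max (f n x) c) \<longlonglongrightarrow> c"
      using c(2)
    proof eventually_elim
      case (elim x)
      then have "eventually (\<lambda>n. max (f n x) c = c) sequentially"
        by eventually_elim auto
      then show ?case by (rule tendsto_eventually)
    qed
    show "AE x in M. norm (max (f n x) c) \<le> 1 + c" for n
      using bound[of _ n] c(1) by (intro AE_I2) (fastforce simp: abs_le_iff)
  qed auto
  then have "(\<lambda>n. \<integral>x. max (f n x) c \<partial>M) \<longlonglongrightarrow> c"
    by (simp add: prob_space)
  then have "eventually (\<lambda>n. (\<integral>x. max (f n x) c \<partial>M) < c + \<eta>) sequentially"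
    using \<open>\<eta> > 0\<close> by (intro order_tendstoD) auto
  then show ?thesis
  proof eventually_elim
    case (elim n)
    have "(\<integral>x. f n x \<partial>M) \<le> (\<integral>x. max (f n x) c \<partial>M)"
    proof (rule integral_mono)
      show "integrable M (f n)"
        using bound by (intro integrable_const_bound[where B=1]) auto
      show "integrable M (\<lambda>x. max (f n x) c)"
        using bound[of _ n] c(1)
        by (intro integrable_const_bound[where B="1+c"] AE_I2) (fastforce simp: abs_le_iff)+
    qed auto
    with elim show ?case by simp
  qed
qed

text \<open>The indicator of a closed set is the pointwise limit of the functions
  \<open>max 0 (1 - j * infdist x K)\<close>, which are Lipschitz with constant \<open>j\<close>.
  The set is nonempty because \<open>infdist\<close> to the empty set is 0.\<close>

lemma closed_measure_diff_le_of_lipschitz: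
  fixes m1 m2 :: "'a::metric_space measure"
  assumes m: "prob_space m1" "sets m1 = sets borel" "prob_space m2" "sets m2 = sets borel"
    and lip: "\<And>f. f \<in> bounded_lipschitz \<Longrightarrow> (\<forall>x. \<bar>f x\<bar> \<le> 1) \<Longrightarrow>
      \<bar>(\<integral>x. f x \<partial>m1) - (\<integral>x. f x \<partial>m2)\<bar> \<le> \<epsilon>"
    and K: "closed K" "K \<noteq> {}"
  shows "\<bar>measure m1 K - measure m2 K\<bar> \<le> \<epsilon>"
proof -
  define f where "f = (\<lambda>(j::nat) x. max 0 (1 - real j * infdist x K))"
  have f01: "0 \<le> f j x" "f j x \<le> 1" for j x
    by (auto simp: f_def infdist_nonneg)
  have inf1: "\<bar>infdist x K - infdist y K\<bar> \<le> dist x y" for x y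
    using infdist_triangle[of x K y] infdist_triangle[of y K x] by (simp add: dist_commute abs_le_iff)
  have fl: "f j \<in> bounded_lipschitz" for j
  proof -
    have "\<bar>f j x - f j y\<bar> \<le> real j * dist x y" for x y
    proof -
      have "\<bar>f j x - f j y\<bar> \<le> \<bar>real j * (infdist x K - infdist y K)\<bar>"
        by (auto simp: f_def right_diff_distrib)
      also have "\<dots> \<le> real j * dist x y"
        using inf1[of x y] by (simp add: abs_mult mult_left_mono)
      finally show ?thesis .
    qed
    moreover have "bounded (range (f j))"
      using f01 by (intro boundedI[where B=1]) auto
    ultimately show ?thesis by (auto simp: bounded_lipschitz_def)
  qed
  have fm: "f j \<in> borel_measurable borel" for j
    unfolding f_def by (intro borel_measurable_continuous_onI continuous_intros)
  have lim: "(\<lambda>j. \<integral>x. f j x \<partial>m) \<longlonglongrightarrow> measure m K" if "prob_space m" "sets m = sets borel" for m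
  proof -
    interpret prob_space m by fact
    have [measurable_cong]: "sets m = sets borel" by fact
    have [measurable]: "K \<in> sets borel" using K by auto
    have "(\<lambda>j. \<integral>x. f j x \<partial>m) \<longlonglongrightarrow> (\<integral>x. indicator K x \<partial>m)"
    proof (rule integral_dominated_convergence[where w="\<lambda>_. 1"])
      show "AE x in m. (\<lambda>j. f j x) \<longlonglongrightarrow> indicat_real K x"
      proof (intro AE_I2)
        fix x
        show "(\<lambda>j. f j x) \<longlonglongrightarrow> indicat_real K x"
        proof (cases "x \<in> K")
          case True then show ?thesis by (simp add: f_def)
        next
          case False
          then have d: "infdist x K > 0"
            using K by (metis in_closed_iff_infdist_zero infdist_nonneg less_eq_real_def)
          obtain N :: nat where N: "real N * infdist x K > 1"
            using reals_Archimedean3[OF d] by blast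
          have "eventually (\<lambda>j. f j x = 0) sequentially"
            using eventually_ge_at_top[of N]
          proof eventually_elim
            case (elim j)
            have "real N * infdist x K \<le> real j * infdist x K"
              using elim d by (intro mult_right_mono) auto
            then show ?case using N by (simp add: f_def)
          qed
          then show ?thesis using False by (simp add: tendsto_eventually)
        qed
      qed
    qed (use fm f01 in \<open>auto cong: measurable_cong_sets\<close>)
    then show ?thesis
      using that by (simp add: sets_eq_imp_space_eq[of m borel])
  qed
  have "(\<lambda>j. \<bar>(\<integral>x. f j x \<partial>m1) - (\<integral>x. f j x \<partial>m2)\<bar>) \<longlonglongrightarrow> \<bar>measure m1 K - measure m2 K\<bar>"
    using m by (intro tendsto_intros lim)
  moreover have "\<bar>(\<integral>x. f j x \<partial>m1) - (\<integral>x. f j x \<partial>m2)\<bar> \<le> \<epsilon>" for j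
    using lip[OF fl] f01 by (auto simp: abs_le_iff intro: order_trans[of _ 0])
  ultimately show ?thesis
    by (intro LIMSEQ_le_const2) auto
qed

text \<open>No bound is put on the Lipschitz constants, so the test functions control the
  total variation distance.\<close>

lemma measure_diff_le_of_lipschitz:
  fixes m1 m2 :: "'a::polish_space measure"
  assumes m1: "prob_space m1" "sets m1 = sets borel" and m2: "prob_space m2" "sets m2 = sets borel"
    and lip: "\<And>f. f \<in> bounded_lipschitz \<Longrightarrow> (\<forall>x. \<bar>f x\<bar> \<le> 1) \<Longrightarrow>
      \<bar>(\<integral>x. f x \<partial>m1) - (\<integral>x. f x \<partial>m2)\<bar> \<le> \<epsilon>"
    and A: "A \<in> sets borel"
  shows "\<bar>measure m1 A - measure m2 A\<bar> \<le> \<epsilon>"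
proof -
  have \<epsilon>: "0 \<le> \<epsilon>"
  proof -
    have "(\<lambda>_::'a. 0::real) \<in> bounded_lipschitz"
      unfolding bounded_lipschitz_def by (auto intro: exI[of _ 0])
    from lip[OF this] show ?thesis by simp
  qed
  \<comment> \<open>Inner regularity on a Polish space approximates \<open>A\<close> from inside by
    compact sets, which bounds the difference from one side; exchanging the two measures gives the
    other side. If the mass of \<open>A\<close> exceeds \<open>e\<close>, the compact set has
    positive mass and so is nonempty.\<close>
  have one: "measure m A - measure m' A \<le> \<epsilon>"
    if m: "prob_space m" "sets m = sets borel" and m': "prob_space m'" "sets m' = sets borel"
      and cl: "\<And>K. closed K \<Longrightarrow> K \<noteq> {} \<Longrightarrow> \<bar>measure m K - measure m' K\<bar> \<le> \<epsilon>"
    for m m' :: "'a measure"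
  proof (rule field_le_epsilon)
    fix e :: real assume e: "e > 0"
    interpret m: prob_space m by fact
    interpret m': prob_space m' by fact
    show "measure m A - measure m' A \<le> \<epsilon> + e"
    proof (cases "measure m A \<le> e")
      case True
      then show ?thesis using \<epsilon> measure_nonneg[of m' A] by linarith
    next
      case False
      then have "emeasure m A > ennreal (measure m A - e)"
        using e by (simp add: m.emeasure_eq_measure ennreal_less_iff)
      then have "\<exists>K. K \<subseteq> A \<and> compact K \<and> ennreal (measure m A - e) < emeasure m K"
        using inner_regular[OF m(2) _ A] by (auto simp: less_SUP_iff)
      then obtain K where K: "K \<subseteq> A" "compact K" "ennreal (measure m A - e) < emeasure m K"
        by blast
      then have 1: "measure m A - e < measure m K"
        using False by (simp add: m.emeasure_eq_measure ennreal_less_iff)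
      have "K \<noteq> {}" using 1 False by auto
      then have "\<bar>measure m K - measure m' K\<bar> \<le> \<epsilon>"
        using cl K by (simp add: compact_imp_closed)
      moreover have "measure m' K \<le> measure m' A"
        using K A m' by (intro m'.finite_measure_mono) auto
      ultimately show ?thesis using 1 by linarith
    qed
  qed
  show ?thesis
    using one[OF m1 m2] one[OF m2 m1] closed_measure_diff_le_of_lipschitz[OF m1 m2 lip]
    by (auto simp: abs_le_iff)
qed

text \<open>The sum counts the \<open>j\<close> with \<open>j / k \<le> u\<close>, of which there
  are \<open>\<lfloor>k * u\<rfloor>\<close>; divided by \<open>k\<close> it is \<open>u\<close>
  rounded down to a multiple of \<open>1 / k\<close>.\<close>

lemma unit_interval_staircase:
  fixes u :: real
  assumes "0 \<le> u" "u \<le> 1" "k > 0"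
  shows "(\<Sum>j=1..k. indicator {v. real j / k \<le> v} u) / k \<le> u"
    and "u \<le> (\<Sum>j=1..k. indicator {v. real j / k \<le> v} u) / k + 1 / k"
proof -
  define N where "N = nat \<lfloor>real k * u\<rfloor>"
  have ku: "0 \<le> real k * u" "real k * u \<le> real k"
    using assms by (auto intro: mult_left_le)
  have N: "real N \<le> real k * u" "real k * u < real N + 1"
    unfolding N_def using ku by linarith+
  have "{j \<in> {1..k}. real j / k \<le> u} = {1..N}"
  proof (intro set_eqI iffI)
    fix j assume "j \<in> {j \<in> {1..k}. real j / k \<le> u}"
    then have "1 \<le> j" "real j \<le> real k * u" using assms by (auto simp: field_simps)
    then have "real j < real (N + 1)" using N by linarith
    then show "j \<in> {1..N}" using \<open>1 \<le> j\<close> by auto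
  next
    fix j assume j: "j \<in> {1..N}"
    then have "real j \<le> real N" by auto
    then have "real j \<le> real k * u" using N by linarith
    moreover from this have "j \<le> k" using ku by linarith
    ultimately show "j \<in> {j \<in> {1..k}. real j / k \<le> u}"
      using assms j by (auto simp: field_simps)
  qed
  then have "card {j \<in> {1..k}. real j / k \<le> u} = N" by simp
  moreover have "(\<Sum>j=1..k. indicator {v. real j / k \<le> v} u :: real) = real (card {j \<in> {1..k}. real j / k \<le> u})"
    by (simp add: indicator_def sum.If_cases Int_def)
  ultimately have s: "(\<Sum>j=1..k. indicator {v. real j / k \<le> v} u :: real) = real N" by simp
  show "(\<Sum>j=1..k. indicator {v. real j / k \<le> v} u) / k \<le> u"
    "u \<le> (\<Sum>j=1..k. indicator {v. real j / k \<le> v} u) / k + 1 / k"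
    unfolding s using N assms by (auto simp: field_simps)
qed

text \<open>Replaces an integral by finitely many measures of level sets, up to
  \<open>1 / k\<close>. Inequalities known only for sets, even for a set function that is merely
  finitely additive, can then be used under an integral.\<close>

lemma (in prob_space) integral_staircase:
  fixes g :: "'a \<Rightarrow> real"
  assumes [measurable]: "g \<in> borel_measurable M"
    and g: "\<And>x. x \<in> space M \<Longrightarrow> 0 \<le> g x \<and> g x \<le> 1" and k: "k > 0"
  shows "(\<Sum>j=1..k. measure M {x \<in> space M. real j / k \<le> g x}) / k \<le> (\<integral>x. g x \<partial>M)"
    and "(\<integral>x. g x \<partial>M) \<le> (\<Sum>j=1..k. measure M {x \<in> space M. real j / k \<le> g x}) / k + 1 / k"
proof -
  define h where "h = (\<lambda>x. (\<Sum>j=1..k. indicator {x \<in> space M. real j / k \<le> g x} x :: real) / k)"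
  have ih: "integrable M (\<lambda>x. indicator {x \<in> space M. real j / k \<le> g x} x :: real)" for j :: nat
    by (intro integrable_const_bound[where B=1]) auto
  have int_h: "integrable M h"
    unfolding h_def using ih by (intro integrable_divide_zero Bochner_Integration.integrable_sum) auto
  have h: "(\<integral>x. h x \<partial>M) = (\<Sum>j=1..k. measure M {x \<in> space M. real j / k \<le> g x}) / k"
    unfolding h_def using ih by (simp add: Int_def conj_commute cong: conj_cong)
  have int_g: "integrable M g"
    using g by (intro integrable_const_bound[where B=1]) auto
  have hx: "h x = (\<Sum>j=1..k. indicator {v. real j / k \<le> v} (g x)) / k" if "x \<in> space M" for x
    using that by (simp add: h_def indicator_def)
  show "(\<Sum>j=1..k. measure M {x \<in> space M. real j / k \<le> g x}) / k \<le> (\<integral>x. g x \<partial>M)"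
    unfolding h[symmetric]
    using unit_interval_staircase(1)[OF _ _ k] g hx by (intro integral_mono int_h int_g) auto
  have "(\<integral>x. g x \<partial>M) \<le> (\<integral>x. h x + 1 / k \<partial>M)"
    using unit_interval_staircase(2)[OF _ _ k] g hx
    by (intro integral_mono int_g Bochner_Integration.integrable_add int_h) auto
  then show "(\<integral>x. g x \<partial>M) \<le> (\<Sum>j=1..k. measure M {x \<in> space M. real j / k \<le> g x}) / k + 1 / k"
    using int_h by (simp add: h prob_space)
qed

text \<open>The rescaled function \<open>(g + K) / (2 * K)\<close> takes values in the unit
  interval, where averaging over level sets gives the bound \<epsilon>; undoing the rescaling gives
  the factor \<open>2 * K\<close>.\<close>

lemma integral_diff_le_of_measure_diff:
  fixes g :: "'a \<Rightarrow> real"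
  assumes "prob_space m1" "prob_space m2" "sets m1 = sets m2"
    and d: "\<And>A. A \<in> sets m1 \<Longrightarrow> \<bar>measure m1 A - measure m2 A\<bar> \<le> \<epsilon>"
    and gm: "g \<in> borel_measurable m1" and g: "\<And>x. x \<in> space m1 \<Longrightarrow> \<bar>g x\<bar> \<le> K" and K: "K > 0"
  shows "\<bar>(\<integral>x. g x \<partial>m1) - (\<integral>x. g x \<partial>m2)\<bar> \<le> 2 * K * \<epsilon>"
proof -
  interpret m1: prob_space m1 by fact
  interpret m2: prob_space m2 by fact
  have [measurable_cong, simp]: "sets m2 = sets m1" and [simp]: "space m2 = space m1"
    using assms(3) sets_eq_imp_space_eq by auto
  note gm [measurable]
  define h where "h = (\<lambda>x. (g x + K) / (2 * K))"
  have [measurable]: "h \<in> borel_measurable m1" unfolding h_def by measurable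
  have h01: "0 \<le> h x \<and> h x \<le> 1" if "x \<in> space m1" for x
    using g[OF that] K by (auto simp: h_def field_simps abs_le_iff)
  have ineq: "\<bar>(\<integral>x. h x \<partial>m1) - (\<integral>x. h x \<partial>m2)\<bar> \<le> \<epsilon> + 1 / k" if k: "k > 0" for k :: nat
  proof -
    define S where "S = (\<lambda>m. (\<Sum>j=1..k. measure m {x \<in> space m1. real j / k \<le> h x}) / k)"
    have "\<bar>S m1 - S m2\<bar> = \<bar>\<Sum>j=1..k. measure m1 {x \<in> space m1. real j / k \<le> h x} - measure m2 {x \<in> space m1. real j / k \<le> h x}\<bar> / k"
      using k by (simp add: S_def sum_subtractf flip: diff_divide_distrib)
    also have "\<dots> \<le> (\<Sum>j=1..k. \<epsilon>) / k"
      by (intro divide_right_mono order_trans[OF sum_abs] sum_mono d) auto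
    also have "\<dots> = \<epsilon>" using k by simp
    finally have "\<bar>S m1 - S m2\<bar> \<le> \<epsilon>" .
    moreover have "S m1 \<le> (\<integral>x. h x \<partial>m1)" "(\<integral>x. h x \<partial>m1) \<le> S m1 + 1 / k"
      using m1.integral_staircase[of h k] h01 k by (auto simp: S_def)
    moreover have "S m2 \<le> (\<integral>x. h x \<partial>m2)" "(\<integral>x. h x \<partial>m2) \<le> S m2 + 1 / k"
      using m2.integral_staircase[of h k] h01 k by (auto simp: S_def)
    ultimately show ?thesis by linarith
  qed
  have "\<bar>(\<integral>x. h x \<partial>m1) - (\<integral>x. h x \<partial>m2)\<bar> \<le> \<epsilon>"
  proof (rule field_le_epsilon)
    fix e :: real assume "e > 0"
    then obtain k :: nat where "k > 0" "1 / k < e"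
      by (metis nat_approx_posE zero_less_Suc)
    with ineq[of k] show "\<bar>(\<integral>x. h x \<partial>m1) - (\<integral>x. h x \<partial>m2)\<bar> \<le> \<epsilon> + e" by linarith
  qed
  moreover have int: "integrable m1 h" "integrable m2 h"
    using h01 by (auto intro!: m1.integrable_const_bound[where B=1] m2.integrable_const_bound[where B=1])
  have gh: "g x = 2 * K * h x - K" for x using K by (simp add: h_def field_simps)
  have "(\<integral>x. g x \<partial>m1) - (\<integral>x. g x \<partial>m2) = 2 * K * ((\<integral>x. h x \<partial>m1) - (\<integral>x. h x \<partial>m2))"
    unfolding gh using int m2.prob_space by (simp add: m1.prob_space algebra_simps)
  ultimately show ?thesis using K by (simp add: abs_mult mult_left_mono)
qed

section \<open>Countably additive parts, cluster points and Baire's theorem\<close>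

text \<open>The outer measure that \<open>L\<close> induces through countable covers is, on
  \<open>sets M\<close>, the largest measure below \<open>L\<close>. Its total mass \<open>c\<close>
  is at least \<delta> by the continuity assumption, and \<mu> is its normalization. The last claim
  is this maximality, stated for probability measures.\<close>

lemma countably_additive_part:
  fixes L :: "'a set \<Rightarrow> real"
  assumes nonneg: "\<And>A. A \<in> sets M \<Longrightarrow> 0 \<le> L A"
    and add: "\<And>A B. A \<in> sets M \<Longrightarrow> B \<in> sets M \<Longrightarrow> A \<inter> B = {} \<Longrightarrow> L (A \<union> B) = L A + L B"
    and \<delta>: "\<delta> > 0"
    and cont: "\<And>A :: nat \<Rightarrow> 'a set. range A \<subseteq> sets M \<Longrightarrow> incseq A \<Longrightarrow> (\<Union>i. A i) = space M \<Longrightarrow> \<exists>k. L (A k) \<ge> \<delta>"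
  obtains \<mu> c where "c > 0" "prob_space \<mu>" "sets \<mu> = sets M"
    "\<And>A. A \<in> sets M \<Longrightarrow> c * measure \<mu> A \<le> L A"
    "\<And>m A. prob_space m \<Longrightarrow> sets m = sets M \<Longrightarrow> (\<And>A. A \<in> sets M \<Longrightarrow> c * measure m A \<le> L A) \<Longrightarrow>
       A \<in> sets M \<Longrightarrow> measure m A \<le> measure \<mu> A"
proof -
  have L0: "L {} = 0" using add[of "{}" "{}"] by simp
  have mono: "L A \<le> L B" if "A \<in> sets M" "B \<in> sets M" "A \<subseteq> B" for A B
    using add[of A "B - A"] nonneg[of "B - A"] that by (simp add: Un_absorb1)
  have sub: "L (A \<union> B) \<le> L A + L B" if "A \<in> sets M" "B \<in> sets M" for A B
    using add[of A "B - A"] mono[of "B - A" B] that by simp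
  define f where "f = (\<lambda>A. ennreal (L A))"
  define \<theta> where "\<theta> = outer_measure (sets M) f"
  have pos: "positive (sets M) f" by (simp add: positive_def f_def L0)
  have inc: "increasing (sets M) f" by (auto simp: increasing_def f_def intro!: ennreal_leI mono)
  have addf: "additive (sets M) f" by (auto simp: additive_def f_def add nonneg ennreal_plus)
  \<comment> \<open>Caratheodory's theorem: finite additivity of \<open>f\<close> puts every set of
    \<open>sets M\<close> into the lambda system of the outer measure.\<close>
  have ms: "measure_space (space M) (sets M) \<theta>"
    unfolding \<theta>_def
    by (rule measure_down[OF sigma_algebra.caratheodory_lemma[OF sigma_algebra_Pow
          sets.outer_measure_space_outer_measure[OF pos inc]] sets.sigma_algebra_axioms
          sets.algebra_subset_lambda_system[OF pos inc addf]])
  define N where "N = measure_of (space M) (sets M) \<theta>"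
  have setsN: "sets N = sets M" and spaceN: "space N = space M"
    by (simp_all add: N_def)
  have emN: "emeasure N A = \<theta> A" if "A \<in> sets M" for A
    using ms that unfolding N_def
    by (intro emeasure_measure_of_sigma) (auto simp: measure_space_def)
  have le: "\<theta> A \<le> f A" if "A \<in> sets M" for A
  proof -
    have "\<theta> A \<le> (\<Sum>i. f ((\<lambda>i. if i = 0 then A else {}) (i::nat)))"
      unfolding \<theta>_def by (rule sets.outer_measure_le[OF pos inc]) (use that in auto)
    also have "\<dots> = (\<Sum>i\<in>{0}. f ((\<lambda>i. if i = 0 then A else {}) (i::nat)))"
      by (rule suminf_finite) (auto simp: f_def L0)
    finally show ?thesis by simp
  qed
  \<comment> \<open>The finite partial unions of a countable cover increase to the space, so one of
    them has \<open>L\<close>-value at least \<delta>; finite subadditivity bounds it by the sum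
    over the cover.\<close>
  have ge: "\<theta> (space M) \<ge> ennreal \<delta>"
    unfolding \<theta>_def outer_measure_def
  proof (rule INF_greatest)
    fix A :: "nat \<Rightarrow> 'a set" assume "A \<in> {A. range A \<subseteq> sets M \<and> disjoint_family A \<and> space M \<subseteq> (\<Union>i. A i)}"
    then have A: "\<And>i. A i \<in> sets M" "space M \<subseteq> (\<Union>i. A i)" by auto
    define C where "C = (\<lambda>k. \<Union>i<k. A i)"
    have C: "C k \<in> sets M" for k unfolding C_def using A by auto
    have "incseq C" unfolding C_def by (intro monoI UN_mono) auto
    moreover have "(\<Union>k. C k) = space M"
      using A sets.sets_into_space[OF A(1)] by (fastforce simp: C_def)
    ultimately obtain k where k: "L (C k) \<ge> \<delta>" using cont[of C] C by auto
    have "L (C k) \<le> (\<Sum>i<k. L (A i))" for k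
    proof (induction k)
      case 0 then show ?case by (simp add: C_def L0)
    next
      case (Suc k)
      have "C (Suc k) = C k \<union> A k" by (auto simp: C_def less_Suc_eq)
      then show ?case using sub[OF C A(1), of k k] Suc by simp
    qed
    with k have "ennreal \<delta> \<le> ennreal (\<Sum>i<k. L (A i))" by (intro ennreal_leI) (meson order_trans)
    also have "\<dots> = (\<Sum>i<k. f (A i))" unfolding f_def using nonneg A by (simp add: sum_ennreal)
    also have "\<dots> \<le> (\<Sum>i. f (A i))" by (rule sum_le_suminf) auto
    finally show "ennreal \<delta> \<le> (\<Sum>i. f (A i))" .
  qed
  interpret N: finite_measure N
    using le[of "space M"] by (intro finite_measureI) (auto simp: emN spaceN f_def top_unique)
  define c where "c = measure N (space M)"
  have cN: "ennreal c = emeasure N (space M)"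
    by (simp add: c_def N.emeasure_eq_measure)
  have c: "c > 0"
    using ge \<delta> emN[of "space M"] cN by (simp add: ennreal_le_iff2) (metis c_def ennreal_le_iff2 le_less_trans less_eq_real_def linorder_not_less measure_nonneg)
  have leN: "measure N A \<le> L A" if "A \<in> sets M" for A
  proof -
    have "ennreal (measure N A) \<le> ennreal (L A)"
      using le[OF that] emN[OF that] by (simp add: f_def flip: N.emeasure_eq_measure)
    then show ?thesis using nonneg[OF that] by (simp add: ennreal_le_iff)
  qed
  define \<mu> where "\<mu> = scale_measure (ennreal (1 / c)) N"
  have m\<mu>: "measure \<mu> A = measure N A / c" for A
    using c by (simp add: \<mu>_def measure_scale_measure)
  have p\<mu>: "prob_space \<mu>"
    using c by (intro prob_spaceI) (simp add: \<mu>_def space_scale_measure spaceN cN[symmetric] flip: ennreal_mult')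
  show thesis
  proof (rule that[of c \<mu>])
    show "sets \<mu> = sets M" by (simp add: \<mu>_def setsN)
    show "c * measure \<mu> A \<le> L A" if "A \<in> sets M" for A
      using leN[OF that] c by (simp add: m\<mu>)
    fix m A assume m: "prob_space m" "sets m = sets M" and mL: "\<And>A. A \<in> sets M \<Longrightarrow> c * measure m A \<le> L A"
      and A: "A \<in> sets M"
    interpret m: prob_space m by fact
    \<comment> \<open>By countable subadditivity of \<open>m\<close>, a multiple of \<open>m\<close>
      lying below \<open>L\<close> is also below the sum of \<open>L\<close> over any countable
      cover of \<open>A\<close>, hence below the infimum of these sums.\<close>
    have "ennreal c * emeasure m A \<le> \<theta> A"
      unfolding \<theta>_def outer_measure_def
    proof (rule INF_greatest)
      fix B :: "nat \<Rightarrow> 'a set" assume "B \<in> {B. range B \<subseteq> sets M \<and> disjoint_family B \<and> A \<subseteq> (\<Union>i. B i)}"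
      then have B: "range B \<subseteq> sets m" "A \<subseteq> (\<Union>i. B i)" using m by auto
      have "emeasure m A \<le> emeasure m (\<Union>i. B i)"
        using B by (intro emeasure_mono) auto
      also have "\<dots> \<le> (\<Sum>i. emeasure m (B i))"
        using B by (intro emeasure_subadditive_countably) auto
      finally have "ennreal c * emeasure m A \<le> ennreal c * (\<Sum>i. emeasure m (B i))"
        by (intro mult_left_mono) auto
      also have "\<dots> = (\<Sum>i. ennreal c * emeasure m (B i))" by simp
      also have "\<dots> \<le> (\<Sum>i. f (B i))"
      proof (intro suminf_le)
        fix i
        have "c * measure m (B i) \<le> L (B i)" using mL B m by auto
        then show "ennreal c * emeasure m (B i) \<le> f (B i)"
          using c by (simp add: f_def m.emeasure_eq_measure ennreal_leI flip: ennreal_mult')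
      qed auto
      finally show "ennreal c * emeasure m A \<le> (\<Sum>i. f (B i))" .
    qed
    then have "ennreal (c * measure m A) \<le> ennreal (measure N A)"
      using emN[OF A] c by (simp add: m.emeasure_eq_measure N.emeasure_eq_measure ennreal_mult')
    then show "measure m A \<le> measure \<mu> A"
      using c by (simp add: m\<mu> field_simps)
  qed (use c p\<mu> in auto)
qed

text \<open>By Tychonoff's theorem the cube is compact in the product topology, so the image filter
  has a cluster point \<open>L\<close>. Pulling its neighbourhoods back to \<open>F\<close> gives a
  finer filter along which all coordinates converge at once; for uncountably many coordinates a
  subsequence need not do this.\<close>

lemma cluster_point_unit_cube:
  fixes \<phi> :: "'t \<Rightarrow> 'i \<Rightarrow> real"
  assumes "F \<noteq> bot" and ev: "eventually (\<lambda>t. \<forall>i. 0 \<le> \<phi> t i \<and> \<phi> t i \<le> 1) F"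
  obtains L G where "G \<noteq> bot" "G \<le> F" "\<And>i. ((\<lambda>t. \<phi> t i) \<longlongrightarrow> L i) G"
proof -
  define U :: "('i \<Rightarrow> real) set" where "U = PiE UNIV (\<lambda>_. {0..1})"
  have "compactin (product_topology (\<lambda>_::'i. euclidean :: real topology) UNIV) U"
    unfolding U_def compactin_PiE by auto
  then have "compact U"
    by (simp add: euclidean_product_topology)
  moreover have "filtermap \<phi> F \<noteq> bot" using assms(1) by (simp add: filtermap_bot_iff)
  moreover have "eventually (\<lambda>x. x \<in> U) (filtermap \<phi> F)"
    using ev by (auto simp: eventually_filtermap U_def PiE_iff elim: eventually_mono)
  ultimately obtain L where L: "inf (nhds L) (filtermap \<phi> F) \<noteq> bot"
    unfolding compact_filter by blast
  define G where "G = inf (filtercomap \<phi> (nhds L)) F"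
  have "G \<noteq> bot"
  proof
    assume "G = bot"
    then obtain P Q where PQ: "eventually P (filtercomap \<phi> (nhds L))" "eventually Q F" "\<And>t. P t \<Longrightarrow> Q t \<Longrightarrow> False"
      unfolding G_def trivial_limit_def eventually_inf by auto
    then obtain R where R: "eventually R (nhds L)" "\<And>t. R (\<phi> t) \<Longrightarrow> P t"
      unfolding eventually_filtercomap by blast
    have "eventually (\<lambda>x. \<not> R x) (filtermap \<phi> F)"
      unfolding eventually_filtermap using PQ(2) by eventually_elim (use R PQ in blast)
    with R(1) have "eventually (\<lambda>_. False) (inf (nhds L) (filtermap \<phi> F))"
      unfolding eventually_inf by blast
    with L show False by (simp add: trivial_limit_def)
  qed
  moreover have "((\<lambda>t. \<phi> t i) \<longlongrightarrow> L i) G" for i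
  proof -
    have "filterlim \<phi> (nhds L) G"
      unfolding G_def by (rule filterlim_mono[OF filterlim_filtercomap]) auto
    show ?thesis
    proof (rule topological_tendstoI)
      fix S :: "real set" assume S: "open S" "L i \<in> S"
      have "open ((\<lambda>x::'i \<Rightarrow> real. x i) -` S)"
        using S(1) continuous_on_product_coordinates[of i] by (intro open_vimage) auto
      with S(2) have "eventually (\<lambda>x. x i \<in> S) (nhds L)"
        by (auto simp: eventually_nhds)
      from eventually_compose_filterlim[OF this \<open>filterlim \<phi> (nhds L) G\<close>]
      show "eventually (\<lambda>t. \<phi> t i \<in> S) G" .
    qed
  qed
  ultimately show thesis using that[of G L] by (simp add: G_def)
qed

text \<open>A closed subset of a complete space is completely metrizable, so the Baire category
  theorem applies to \<open>S\<close> with its subspace topology. The interior is relative to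
  \<open>S\<close>, hence the intersections with \<open>W\<close>.\<close>

lemma Baire_closed_cover_interior:
  fixes S :: "'a::complete_space set"
  assumes "closed S" "S \<noteq> {}" "\<And>n::nat. closed (B n)" "S \<subseteq> (\<Union>n. B n)"
  obtains n W where "open W" "W \<inter> S \<noteq> {}" "W \<inter> S \<subseteq> B n"
proof (rule ccontr)
  assume not: "\<not> thesis"
  let ?X = "top_of_set S"
  have "?X interior_of \<Union>(range (\<lambda>n. S \<inter> B n)) = {}"
  proof (rule Baire_category_alt)
    show "completely_metrizable_space ?X \<or> locally_compact_space ?X \<and> regular_space ?X"
      using assms(1) completely_metrizable_space_closedin[OF completely_metrizable_space_euclidean, of S]
      by simp
    fix T assume "T \<in> range (\<lambda>n. S \<inter> B n)"
    then obtain n where n: "T = S \<inter> B n" by auto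
    have "?X interior_of T = {}"
    proof (rule ccontr)
      assume "?X interior_of T \<noteq> {}"
      then obtain U where "openin ?X U" "U \<subseteq> T" "U \<noteq> {}"
        by (metis interior_of_subset openin_interior_of)
      then obtain W where "open W" "U = S \<inter> W" by (auto simp: openin_open)
      with \<open>U \<subseteq> T\<close> \<open>U \<noteq> {}\<close> n show False using not that[of W n] by blast
    qed
    then show "closedin ?X T \<and> ?X interior_of T = {}"
      using n assms by (auto simp: closedin_closed_Int)
  qed auto
  moreover have "\<Union>(range (\<lambda>n. S \<inter> B n)) = S" using assms(4) by auto
  ultimately show False using assms(2)
    by (metis interior_of_topspace topspace_euclidean_subtopology)
qed

section \<open>Merging of laws\<close>

text \<open>Here \<nu> is \<open>m\<close> conditioned on \<open>B\<close>, with density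
  \<open>u = indicator B / m(B)\<close>, and \<mu> is the normalized remainder, with density
  \<open>(1 - \<beta> * u) / (1 - \<beta>)\<close>. The latter is nonnegative because \<beta> is at
  most the mass of \<open>B\<close>.\<close>

lemma prob_space_split_off_set:
  assumes "prob_space m" and B [measurable]: "B \<in> sets m" and \<beta>: "0 < \<beta>" "\<beta> < 1" "\<beta> \<le> measure m B"
  obtains \<nu> \<mu> where "prob_space \<nu>" "sets \<nu> = sets m" "AE x in \<nu>. x \<in> B"
    "prob_space \<mu>" "sets \<mu> = sets m"
    "\<And>g :: 'a \<Rightarrow> real. g \<in> borel_measurable m \<Longrightarrow> (\<And>x. x \<in> space m \<Longrightarrow> \<bar>g x\<bar> \<le> 1) \<Longrightarrow>
       (\<integral>x. g x \<partial>m) = \<beta> * (\<integral>x. g x \<partial>\<nu>) + (1 - \<beta>) * (\<integral>x. g x \<partial>\<mu>)"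
proof -
  interpret m: prob_space m by fact
  define b where "b = measure m B"
  have b: "0 < b" "\<beta> \<le> b" using \<beta> by (auto simp: b_def)
  define u where "u = (\<lambda>x. indicator B x / b :: real)"
  define v where "v = (\<lambda>x. (1 - \<beta> * u x) / (1 - \<beta>))"
  have u0: "0 \<le> u x" for x using b by (simp add: u_def)
  have v0: "0 \<le> v x" for x using b \<beta> by (auto simp: v_def u_def indicator_def divide_simps)
  have [measurable]: "u \<in> borel_measurable m" "v \<in> borel_measurable m"
    unfolding u_def v_def by measurable
  have iu: "integrable m u" unfolding u_def
    by (intro integrable_divide_zero integrable_real_indicator) (auto simp: m.emeasure_eq_measure)
  have int_u: "(\<integral>x. u x \<partial>m) = 1"
    using b by (simp add: u_def) (simp add: b_def)
  have iv: "integrable m v" unfolding v_def using iu by simp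
  have int_v: "(\<integral>x. v x \<partial>m) = 1"
    using iu int_u \<beta> by (simp add: v_def m.prob_space)
  have prob_density: "prob_space (density m (\<lambda>x. ennreal (w x)))"
    if "integrable m w" "\<And>x. 0 \<le> w x" "(\<integral>x. w x \<partial>m) = 1" for w
  proof (rule prob_spaceI)
    show "emeasure (density m (\<lambda>x. ennreal (w x))) (space (density m (\<lambda>x. ennreal (w x)))) = 1"
      using that by (subst emeasure_density) (auto simp: nn_integral_eq_integral cong: nn_integral_cong)
  qed
  show thesis
  proof (rule that[of "density m (\<lambda>x. ennreal (u x))" "density m (\<lambda>x. ennreal (v x))"])
    show "prob_space (density m (\<lambda>x. ennreal (u x)))" "prob_space (density m (\<lambda>x. ennreal (v x)))"
      using prob_density iu iv int_u int_v u0 v0 by auto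
    show "AE x in density m (\<lambda>x. ennreal (u x)). x \<in> B"
      by (subst AE_density) (auto simp: u_def indicator_def)
    fix g :: "'a \<Rightarrow> real" assume [measurable]: "g \<in> borel_measurable m" and g: "\<And>x. x \<in> space m \<Longrightarrow> \<bar>g x\<bar> \<le> 1"
    have ig: "integrable m g" using g by (intro m.integrable_const_bound[where B=1]) auto
    have igu: "integrable m (\<lambda>x. u x * g x)"
      unfolding u_def using integrable_mult_indicator[OF B ig] by simp
    have "(\<integral>x. g x \<partial>m) = (\<integral>x. \<beta> * (u x * g x) + (1 - \<beta>) * (v x * g x) \<partial>m)"
      using \<beta> by (intro Bochner_Integration.integral_cong) (auto simp: v_def field_simps)
    also have "\<dots> = \<beta> * (\<integral>x. u x * g x \<partial>m) + (1 - \<beta>) * (\<integral>x. v x * g x \<partial>m)"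
    proof -
      have "integrable m (\<lambda>x. v x * g x)"
      proof -
        have "v x * g x = (g x - \<beta> * (u x * g x)) / (1 - \<beta>)" for x
          by (simp add: v_def algebra_simps)
        then show ?thesis using ig igu by simp
      qed
      then show ?thesis using igu by simp
    qed
    finally show "(\<integral>x. g x \<partial>m) = \<beta> * (\<integral>x. g x \<partial>density m (\<lambda>x. ennreal (u x))) + (1 - \<beta>) * (\<integral>x. g x \<partial>density m (\<lambda>x. ennreal (v x)))"
      using u0 v0 by (simp add: integral_density)
  qed auto
qed

section \<open>Feller transition kernels and the laws they propagate\<close>

locale feller_kernels =
  fixes p :: "real \<Rightarrow> 'a::polish_space \<Rightarrow> 'a measure"
  assumes prob_p: "0 \<le> t \<Longrightarrow> prob_space (p t x)"
    and sets_p [simp, measurable_cong]: "sets (p t x) = sets borel"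
    and measurable_p: "0 \<le> t \<Longrightarrow> A \<in> sets borel \<Longrightarrow> (\<lambda>x. measure (p t x) A) \<in> borel_measurable borel"
    and p_zero: "A \<in> sets borel \<Longrightarrow> measure (p 0 x) A = indicator A x"
    and chapman_kolmogorov: "0 \<le> s \<Longrightarrow> 0 \<le> t \<Longrightarrow> A \<in> sets borel \<Longrightarrow>
      measure (p (s + t) x) A = (\<integral>y. measure (p t y) A \<partial>p s x)"
    and feller_p: "0 \<le> t \<Longrightarrow> continuous_on UNIV f \<Longrightarrow> bounded (range f) \<Longrightarrow>
      continuous_on UNIV (\<lambda>x. \<integral>y. f y \<partial>p t x :: real)"
begin

text \<open>The distribution at time \<open>t\<close> of the process with initial law \<mu>, kept as
  a real-valued set function; \<open>bind_p\<close> identifies it with the measure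
  \<open>\<mu> \<bind> p t\<close>.\<close>

definition law :: "'a measure \<Rightarrow> real \<Rightarrow> 'a set \<Rightarrow> real" where
  "law \<mu> t A = (\<integral>x. measure (p t x) A \<partial>\<mu>)"

lemma space_p [simp]: "space (p t x) = UNIV"
  using sets_eq_imp_space_eq[OF sets_p] by simp

lemma measure_p_le_1: "0 \<le> t \<Longrightarrow> measure (p t x) A \<le> 1"
  using prob_p prob_space.prob_le_1 by blast

lemma kernel_p [measurable]: "0 \<le> t \<Longrightarrow> p t \<in> borel \<rightarrow>\<^sub>M subprob_algebra borel"
proof (rule measurable_subprob_algebra)
  fix A :: "'a set" assume "0 \<le> t" "A \<in> sets borel"
  then have "(\<lambda>x. ennreal (measure (p t x) A)) \<in> borel_measurable borel"
    using measurable_p by measurable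
  then show "(\<lambda>x. emeasure (p t x) A) \<in> borel_measurable borel"
    using prob_p[OF \<open>0 \<le> t\<close>] by (simp add: finite_measure.emeasure_eq_measure prob_space_def)
qed (auto intro: prob_p prob_space_imp_subprob_space)

lemma integrable_measure_p:
  assumes "prob_space \<mu>" "sets \<mu> = sets borel" "0 \<le> t" "A \<in> sets borel"
  shows "integrable \<mu> (\<lambda>x. measure (p t x) A)"
proof -
  interpret prob_space \<mu> by fact
  note assms(2)[measurable_cong]
  show ?thesis using assms measurable_p measure_p_le_1
    by (intro integrable_const_bound[where B=1]) (auto cong: measurable_cong_sets)
qed

lemma law_bounds:
  assumes "prob_space \<mu>" "sets \<mu> = sets borel" "0 \<le> t" "A \<in> sets borel"
  shows "0 \<le> law \<mu> t A" "law \<mu> t A \<le> 1"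
proof -
  interpret prob_space \<mu> by fact
  show "0 \<le> law \<mu> t A" unfolding law_def by (intro Bochner_Integration.integral_nonneg) auto
  have "law \<mu> t A \<le> (\<integral>x. 1 \<partial>\<mu>)"
    unfolding law_def using integrable_measure_p[OF assms] measure_p_le_1 assms
    by (intro integral_mono) auto
  then show "law \<mu> t A \<le> 1" by (simp add: prob_space)
qed

text \<open>Allows the evolution to be stopped at time \<open>s\<close> and restarted from the law
  reached there. The last claim is the Chapman-Kolmogorov equation integrated against \<mu>.\<close>

lemma bind_p:
  assumes "prob_space \<mu>" and sets_\<mu>: "sets \<mu> = sets borel" and s: "0 \<le> s"
  shows "prob_space (\<mu> \<bind> p s)" "sets (\<mu> \<bind> p s) = sets borel"
    and "A \<in> sets borel \<Longrightarrow> measure (\<mu> \<bind> p s) A = law \<mu> s A"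
    and "A \<in> sets borel \<Longrightarrow> 0 \<le> t \<Longrightarrow> law (\<mu> \<bind> p s) t A = law \<mu> (s + t) A"
proof -
  interpret prob_space \<mu> by fact
  interpret subprob_space \<mu> by (rule prob_space_imp_subprob_space) fact
  have k: "p s \<in> \<mu> \<rightarrow>\<^sub>M subprob_algebra borel"
    using kernel_p[OF s] sets_\<mu> by (simp cong: measurable_cong_sets)
  show "prob_space (\<mu> \<bind> p s)"
    using prob_p[OF s] by (intro prob_space_bind[OF _ k]) auto
  show "sets (\<mu> \<bind> p s) = sets borel"
    by (rule sets_bind) (auto simp: not_empty)
  show "A \<in> sets borel \<Longrightarrow> measure (\<mu> \<bind> p s) A = law \<mu> s A"
    unfolding law_def by (rule measure_bind[OF k])
  assume A: "A \<in> sets borel" and t: "0 \<le> t"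
  have "law (\<mu> \<bind> p s) t A = (\<integral>x. \<integral>y. measure (p t y) A \<partial>p s x \<partial>\<mu>)"
    unfolding law_def
    by (rule integral_bind[where K=borel and B=1 and B'=1])
      (use k measurable_p A t s measure_p_le_1 prob_p in \<open>auto simp: finite_measure_axioms prob_space.emeasure_space_1[OF prob_p[OF s], simplified]\<close>)
  then show "law (\<mu> \<bind> p s) t A = law \<mu> (s + t) A"
    using A s t by (simp add: law_def chapman_kolmogorov)
qed

lemma law_return: "0 \<le> t \<Longrightarrow> A \<in> sets borel \<Longrightarrow> law (return borel x) t A = measure (p t x) A"
  unfolding law_def by (subst integral_return) (auto intro: measurable_p)

lemma law_p: "0 \<le> s \<Longrightarrow> 0 \<le> t \<Longrightarrow> A \<in> sets borel \<Longrightarrow> law (p s x) t A = measure (p (s + t) x) A"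
  by (simp add: law_def chapman_kolmogorov)

end

text \<open>Eventual continuity and the lower bound at \<open>z\<close>, with upper and lower limits
  rewritten as eventual inequalities. The radius and the constant \<alpha> are uniform in the
  starting point, but the time from which the inequalities hold may depend on it.\<close>

locale stable_kernels = feller_kernels p for p :: "real \<Rightarrow> 'a::polish_space \<Rightarrow> 'a measure" +
  fixes z :: 'a
  assumes eventually_continuous: "\<epsilon> > 0 \<Longrightarrow> \<exists>r>0. \<forall>x\<in>ball z r. eventually (\<lambda>t. \<forall>f\<in>bounded_lipschitz.
      (\<forall>x. \<bar>f x\<bar> \<le> 1) \<longrightarrow> \<bar>(\<integral>y. f y \<partial>p t x) - (\<integral>y. f y \<partial>p t z)\<bar> \<le> \<epsilon>) at_top"
    and lower_bound: "r > 0 \<Longrightarrow> \<exists>\<alpha>>0. \<forall>x. eventually (\<lambda>t. measure (p t x) (ball z r) \<ge> \<alpha>) at_top"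
begin

lemma eventually_continuous_sets:
  assumes "\<epsilon> > 0"
  obtains r where "r > 0" "\<And>x. x \<in> ball z r \<Longrightarrow>
    eventually (\<lambda>t. \<forall>A\<in>sets borel. \<bar>measure (p t x) A - measure (p t z) A\<bar> \<le> \<epsilon>) at_top"
proof -
  obtain r where r: "r > 0" "\<And>x. x \<in> ball z r \<Longrightarrow> eventually (\<lambda>t. \<forall>f\<in>bounded_lipschitz.
      (\<forall>x. \<bar>f x\<bar> \<le> 1) \<longrightarrow> \<bar>(\<integral>y. f y \<partial>p t x) - (\<integral>y. f y \<partial>p t z)\<bar> \<le> \<epsilon>) at_top"
    using eventually_continuous[OF assms] by blast
  show thesis
  proof (rule that[OF r(1)])
    fix x assume "x \<in> ball z r"
    from r(2)[OF this] eventually_ge_at_top[of 0]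
    show "eventually (\<lambda>t. \<forall>A\<in>sets borel. \<bar>measure (p t x) A - measure (p t z) A\<bar> \<le> \<epsilon>) at_top"
    proof eventually_elim
      case (elim t)
      then show ?case
        by (intro ballI measure_diff_le_of_lipschitz) (auto intro: prob_p)
    qed
  qed
qed

text \<open>The waiting time depends on the starting point, so averaging over \<mu> loses an
  arbitrarily small amount of mass: \<alpha> drops to any \<beta> below it. Dominated convergence is
  applied to the mass outside \<open>B\<close>.\<close>

lemma law_ge_eventually:
  assumes "prob_space \<mu>" and sets_\<mu>: "sets \<mu> = sets borel" and B: "B \<in> sets borel"
    and ev: "\<And>x. eventually (\<lambda>t. measure (p t x) B \<ge> \<alpha>) at_top" and "\<beta> < \<alpha>"
  shows "eventually (\<lambda>t. law \<mu> t B \<ge> \<beta>) at_top"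
proof (rule eventually_at_top_if_sequentially)
  fix T :: "nat \<Rightarrow> real" assume T: "\<And>n. T n \<ge> real n"
  interpret prob_space \<mu> by fact
  note sets_\<mu>[measurable_cong]
  have T0: "T n \<ge> 0" for n using T[of n] by (rule order_trans[rotated]) simp
  \<comment> \<open>A constant statement that holds eventually holds outright. It makes
    \<open>1 - \<alpha>\<close> nonnegative, as the lemma on integrals requires.\<close>
  have "eventually (\<lambda>t. \<alpha> \<le> 1) (at_top :: real filter)"
    using ev[of z] eventually_ge_at_top[of 0] by eventually_elim (meson measure_p_le_1 order_trans)
  then have \<alpha>: "\<alpha> \<le> 1" by simp
  have "eventually (\<lambda>n. (\<integral>x. 1 - measure (p (T n) x) B \<partial>\<mu>) \<le> (1 - \<alpha>) + (\<alpha> - \<beta>)) sequentially"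
  proof (rule integral_le_of_eventually_le)
    show "(\<lambda>x. 1 - measure (p (T n) x) B) \<in> borel_measurable \<mu>" for n
      using measurable_p[OF T0 B] by measurable
    show "\<bar>1 - measure (p (T n) x) B\<bar> \<le> 1" for n x
      using measure_p_le_1[OF T0] by (auto simp: abs_le_iff)
    show "AE x in \<mu>. \<forall>\<^sub>F n in sequentially. 1 - measure (p (T n) x) B \<le> 1 - \<alpha>"
      using eventually_compose_filterlim[OF ev filterlim_real_seq_at_top[OF T]] by simp
  qed (use \<open>\<beta> < \<alpha>\<close> \<alpha> in auto)
  then obtain n where "(\<integral>x. 1 - measure (p (T n) x) B \<partial>\<mu>) \<le> (1 - \<alpha>) + (\<alpha> - \<beta>)"
    by (auto simp: eventually_sequentially)
  then have "law \<mu> (T n) B \<ge> \<beta>"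
    using integrable_measure_p[OF assms(1,2) T0 B] by (simp add: law_def prob_space)
  then show "\<exists>n. law \<mu> (T n) B \<ge> \<beta>" ..
qed

text \<open>Passing to a sequence of times and sets avoids suprema of uncountably many measurable
  functions.\<close>

lemma law_near_eventually:
  assumes "prob_space \<nu>" and sets_\<nu>: "sets \<nu> = sets borel" and B: "AE x in \<nu>. x \<in> B"
    and ev: "\<And>x. x \<in> B \<Longrightarrow>
      eventually (\<lambda>t. \<forall>A\<in>sets borel. \<bar>measure (p t x) A - measure (p t z) A\<bar> \<le> \<epsilon>) at_top"
    and "\<epsilon> \<ge> 0" "\<eta> > 0"
  shows "eventually (\<lambda>t. \<forall>A\<in>sets borel. \<bar>law \<nu> t A - measure (p t z) A\<bar> \<le> \<epsilon> + \<eta>) at_top"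
proof (rule eventually_at_top_if_sequentially, rule ccontr)
  fix T :: "nat \<Rightarrow> real" assume T: "\<And>n. T n \<ge> real n"
    and not: "\<nexists>n. \<forall>A\<in>sets borel. \<bar>law \<nu> (T n) A - measure (p (T n) z) A\<bar> \<le> \<epsilon> + \<eta>"
  interpret prob_space \<nu> by fact
  note sets_\<nu>[measurable_cong]
  have T0: "T n \<ge> 0" for n using T[of n] by (rule order_trans[rotated]) simp
  obtain A where A: "\<And>n. A n \<in> sets borel"
      "\<And>n. \<not> \<bar>law \<nu> (T n) (A n) - measure (p (T n) z) (A n)\<bar> \<le> \<epsilon> + \<eta>"
    using not by metis
  define g where "g = (\<lambda>n x. measure (p (T n) x) (A n) - measure (p (T n) z) (A n))"
  have [measurable]: "g n \<in> borel_measurable \<nu>" for n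
    unfolding g_def using measurable_p[OF T0 A(1), of n n] by measurable
  have "\<bar>g n x\<bar> \<le> 1" for n x
    using measure_p_le_1[OF T0, of n x "A n"] measure_p_le_1[OF T0, of n z "A n"]
      measure_nonneg[of "p (T n) x" "A n"] measure_nonneg[of "p (T n) z" "A n"]
    unfolding g_def by linarith
  note g1 = this
  have "eventually (\<lambda>n. (\<integral>x. \<bar>g n x\<bar> \<partial>\<nu>) \<le> \<epsilon> + \<eta>) sequentially"
  proof (rule integral_le_of_eventually_le)
    show "AE x in \<nu>. \<forall>\<^sub>F n in sequentially. \<bar>g n x\<bar> \<le> \<epsilon>"
      using B
    proof eventually_elim
      case (elim x)
      from eventually_compose_filterlim[OF ev[OF elim] filterlim_real_seq_at_top[OF T]]
      show ?case by eventually_elim (use A in \<open>auto simp: g_def\<close>)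
    qed
  qed (use assms g1 in auto)
  then obtain n where n: "(\<integral>x. \<bar>g n x\<bar> \<partial>\<nu>) \<le> \<epsilon> + \<eta>"
    by (auto simp: eventually_sequentially)
  have "(\<integral>x. g n x \<partial>\<nu>) = law \<nu> (T n) (A n) - measure (p (T n) z) (A n)"
    unfolding g_def law_def using integrable_measure_p[OF assms(1,2) T0 A(1), of n n]
    by (simp add: prob_space)
  moreover have "\<bar>\<integral>x. g n x \<partial>\<nu>\<bar> \<le> (\<integral>x. \<bar>g n x\<bar> \<partial>\<nu>)"
    by (rule integral_abs_bound)
  ultimately show False using A(2)[of n] n by simp
qed

text \<open>If two laws both give mass at least \<beta> to the ball at a common time, their parts in
  the ball merge up to \<open>2 * \<epsilon>\<close> and the error of the remainders is multiplied
  by \<open>1 - \<beta>\<close>. The bound is what this recursion yields, starting from the trivial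
  distance 1. The constant \<beta> depends on \<epsilon> but not on \<open>k\<close> or on the
  laws.\<close>

lemma laws_merge_bound:
  assumes "\<epsilon> > 0"
  obtains \<beta> where "0 < \<beta>" "\<beta> < 1"
    "\<And>k \<mu>1 \<mu>2 \<eta>. prob_space \<mu>1 \<Longrightarrow> sets \<mu>1 = sets borel \<Longrightarrow> prob_space \<mu>2 \<Longrightarrow> sets \<mu>2 = sets borel \<Longrightarrow> \<eta> > 0 \<Longrightarrow>
      eventually (\<lambda>t. \<forall>A\<in>sets borel. \<bar>law \<mu>1 t A - law \<mu>2 t A\<bar> \<le> 2 * \<epsilon> + (1 - \<beta>) ^ k + \<eta>) at_top"
proof -
  obtain r where r: "r > 0" "\<And>x. x \<in> ball z r \<Longrightarrow>
    eventually (\<lambda>t. \<forall>A\<in>sets borel. \<bar>measure (p t x) A - measure (p t z) A\<bar> \<le> \<epsilon>) at_top"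
    using eventually_continuous_sets[OF assms] by blast
  obtain \<alpha> where \<alpha>: "\<alpha> > 0" "\<And>x. eventually (\<lambda>t. measure (p t x) (ball z r) \<ge> \<alpha>) at_top"
    using lower_bound[OF r(1)] by blast
  \<comment> \<open>Strictly below \<alpha>, because averaging over the initial law costs a little
    mass, and below 1, so that the remainder can be normalized.\<close>
  define \<beta> where "\<beta> = min (1/2) (\<alpha> / 2)"
  have \<beta>: "0 < \<beta>" "\<beta> < 1" "\<beta> < \<alpha>" using \<alpha> by (auto simp: \<beta>_def)
  have "eventually (\<lambda>t. \<forall>A\<in>sets borel. \<bar>law \<mu>1 t A - law \<mu>2 t A\<bar> \<le> 2 * \<epsilon> + (1 - \<beta>) ^ k + \<eta>) at_top"
    if "prob_space \<mu>1" "sets \<mu>1 = sets borel" "prob_space \<mu>2" "sets \<mu>2 = sets borel" "\<eta> > 0" for k \<mu>1 \<mu>2 \<eta>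
    using that
  \<comment> \<open>The laws are arbitrary because the induction hypothesis is applied to the
    remainders, which are different initial laws.\<close>
  proof (induction k arbitrary: \<mu>1 \<mu>2 \<eta>)
    case 0
    from eventually_ge_at_top[of 0] show ?case
    proof eventually_elim
      case (elim t)
      show ?case
      proof
        fix A :: "'a set" assume "A \<in> sets borel"
        with law_bounds[OF 0(1,2) elim this] law_bounds[OF 0(3,4) elim this] assms 0(5)
        show "\<bar>law \<mu>1 t A - law \<mu>2 t A\<bar> \<le> 2 * \<epsilon> + (1 - \<beta>) ^ 0 + \<eta>"
          by (simp add: abs_le_iff)
      qed
    qed
  next
    case (Suc k)
    have "eventually (\<lambda>t. t \<ge> 0 \<and> law \<mu>1 t (ball z r) \<ge> \<beta> \<and> law \<mu>2 t (ball z r) \<ge> \<beta>) at_top"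
      using law_ge_eventually[OF Suc.prems(1,2) _ \<alpha>(2) \<beta>(3)] law_ge_eventually[OF Suc.prems(3,4) _ \<alpha>(2) \<beta>(3)]
      by (intro eventually_conj eventually_ge_at_top) auto
    then obtain s where s: "s \<ge> 0" "law \<mu>1 s (ball z r) \<ge> \<beta>" "law \<mu>2 s (ball z r) \<ge> \<beta>"
      by (auto simp: eventually_at_top_linorder)
    have split: "\<exists>\<nu> \<mu>'. prob_space \<nu> \<and> sets \<nu> = sets borel \<and> (AE x in \<nu>. x \<in> ball z r) \<and>
        prob_space \<mu>' \<and> sets \<mu>' = sets borel \<and>
        (\<forall>t\<ge>0. \<forall>A\<in>sets borel. law \<mu> (s + t) A = \<beta> * law \<nu> t A + (1 - \<beta>) * law \<mu>' t A)"
      if \<mu>: "prob_space \<mu>" "sets \<mu> = sets borel" and mb: "law \<mu> s (ball z r) \<ge> \<beta>" for \<mu>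
    proof -
      note bp = bind_p[OF \<mu> s(1)]
      have "ball z r \<in> sets (\<mu> \<bind> p s)" "\<beta> \<le> measure (\<mu> \<bind> p s) (ball z r)"
        using bp mb by auto
      from prob_space_split_off_set[OF bp(1) this(1) \<beta>(1,2) this(2)]
      obtain \<nu> \<mu>' where *: "prob_space \<nu>" "sets \<nu> = sets (\<mu> \<bind> p s)" "AE x in \<nu>. x \<in> ball z r"
        "prob_space \<mu>'" "sets \<mu>' = sets (\<mu> \<bind> p s)"
        "\<And>g :: 'a \<Rightarrow> real. g \<in> borel_measurable (\<mu> \<bind> p s) \<Longrightarrow> (\<And>x. x \<in> space (\<mu> \<bind> p s) \<Longrightarrow> \<bar>g x\<bar> \<le> 1) \<Longrightarrow>
          (\<integral>x. g x \<partial>(\<mu> \<bind> p s)) = \<beta> * (\<integral>x. g x \<partial>\<nu>) + (1 - \<beta>) * (\<integral>x. g x \<partial>\<mu>')"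
        by metis
      have "law \<mu> (s + t) A = \<beta> * law \<nu> t A + (1 - \<beta>) * law \<mu>' t A" if "t \<ge> 0" "A \<in> sets borel" for t A
        unfolding bp(4)[OF that(2,1), symmetric]
        unfolding law_def
        using that measurable_p measure_p_le_1 bp(2)
        by (intro *(6)) (auto cong: measurable_cong_sets)
      with * bp(2) show ?thesis by auto
    qed
    obtain \<nu>1 \<mu>1' where 1: "prob_space \<nu>1" "sets \<nu>1 = sets borel" "AE x in \<nu>1. x \<in> ball z r"
      "prob_space \<mu>1'" "sets \<mu>1' = sets borel"
      "\<And>t A. t \<ge> 0 \<Longrightarrow> A \<in> sets borel \<Longrightarrow> law \<mu>1 (s + t) A = \<beta> * law \<nu>1 t A + (1 - \<beta>) * law \<mu>1' t A"
      using split[OF Suc.prems(1,2) s(2)] by blast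
    obtain \<nu>2 \<mu>2' where 2: "prob_space \<nu>2" "sets \<nu>2 = sets borel" "AE x in \<nu>2. x \<in> ball z r"
      "prob_space \<mu>2'" "sets \<mu>2' = sets borel"
      "\<And>t A. t \<ge> 0 \<Longrightarrow> A \<in> sets borel \<Longrightarrow> law \<mu>2 (s + t) A = \<beta> * law \<nu>2 t A + (1 - \<beta>) * law \<mu>2' t A"
      using split[OF Suc.prems(3,4) s(3)] by blast
    \<comment> \<open>Each of the two parts in the ball is compared with the law from
      \<open>z\<close> up to \<open>\<eta> / 2\<close>. The remainders merge up to \<eta>, and the
      convex combination with weights \<beta> and \<open>1 - \<beta>\<close> keeps this error at
      \<eta>, so it does not accumulate over the rounds.\<close>
    have h: "\<eta> / 2 > 0" using Suc.prems by simp
    note near = law_near_eventually[OF _ _ _ r(2) less_imp_le[OF assms] h]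
    from near[OF 1(1,2,3), simplified] near[OF 2(1,2,3), simplified] Suc.IH[OF 1(4,5) 2(4,5) Suc.prems(5)] eventually_ge_at_top[of 0]
    have "eventually (\<lambda>t. \<forall>A\<in>sets borel. \<bar>law \<mu>1 (t + s) A - law \<mu>2 (t + s) A\<bar> \<le> 2 * \<epsilon> + (1 - \<beta>) ^ Suc k + \<eta>) at_top"
    proof eventually_elim
      case (elim t)
      show ?case
      proof
        fix A :: "'a set" assume A: "A \<in> sets borel"
        let ?a = "law \<nu>1 t A - law \<nu>2 t A" and ?b = "law \<mu>1' t A - law \<mu>2' t A"
        have "\<bar>law \<nu>1 t A - measure (p t z) A\<bar> \<le> \<epsilon> + \<eta> / 2" "\<bar>law \<nu>2 t A - measure (p t z) A\<bar> \<le> \<epsilon> + \<eta> / 2"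
          using elim A by auto
        then have a: "\<bar>?a\<bar> \<le> 2 * \<epsilon> + \<eta>" by linarith
        have b: "\<bar>?b\<bar> \<le> 2 * \<epsilon> + (1 - \<beta>) ^ k + \<eta>" using elim A by auto
        have "law \<mu>1 (s + t) A - law \<mu>2 (s + t) A = \<beta> * ?a + (1 - \<beta>) * ?b"
          using 1(6)[OF elim(4) A] 2(6)[OF elim(4) A] by (simp add: algebra_simps)
        then have "\<bar>law \<mu>1 (s + t) A - law \<mu>2 (s + t) A\<bar> \<le> \<beta> * \<bar>?a\<bar> + (1 - \<beta>) * \<bar>?b\<bar>"
          using \<beta> abs_triangle_ineq[of "\<beta> * ?a" "(1 - \<beta>) * ?b"] by (simp add: abs_mult)
        also have "\<dots> \<le> \<beta> * (2 * \<epsilon> + \<eta>) + (1 - \<beta>) * (2 * \<epsilon> + (1 - \<beta>) ^ k + \<eta>)"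
          using a b \<beta> by (intro add_mono mult_left_mono) auto
        also have "\<dots> = 2 * \<epsilon> + (1 - \<beta>) ^ Suc k + \<eta>" by (simp add: algebra_simps)
        finally show "\<bar>law \<mu>1 (t + s) A - law \<mu>2 (t + s) A\<bar> \<le> 2 * \<epsilon> + (1 - \<beta>) ^ Suc k + \<eta>"
          by (simp add: add.commute)
      qed
    qed
    then show ?case by (rule eventually_at_top_shiftD)
  qed
  with \<beta> that show thesis by blast
qed

text \<open>The order of choices matters: the accuracy \<open>\<epsilon> / 4\<close> fixes \<beta>,
  and only then is \<open>k\<close> taken so large that \<open>(1 - \<beta>) ^ k\<close> is below
  \<open>\<epsilon> / 4\<close>.\<close>

theorem laws_merge:
  assumes "prob_space \<mu>1" "sets \<mu>1 = sets borel" "prob_space \<mu>2" "sets \<mu>2 = sets borel" "\<epsilon> > 0"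
  shows "eventually (\<lambda>t. \<forall>A\<in>sets borel. \<bar>law \<mu>1 t A - law \<mu>2 t A\<bar> \<le> \<epsilon>) at_top"
proof -
  have "\<epsilon> / 4 > 0" using assms by simp
  show ?thesis
  proof (rule laws_merge_bound[OF \<open>\<epsilon> / 4 > 0\<close>])
    fix \<beta> assume \<beta>: "0 < \<beta>" "\<beta> < 1"
      and *: "\<And>k \<mu>1 \<mu>2 \<eta>. prob_space \<mu>1 \<Longrightarrow> sets \<mu>1 = sets borel \<Longrightarrow> prob_space \<mu>2 \<Longrightarrow> sets \<mu>2 = sets borel \<Longrightarrow> \<eta> > 0 \<Longrightarrow>
        eventually (\<lambda>t. \<forall>A\<in>sets borel. \<bar>law \<mu>1 t A - law \<mu>2 t A\<bar> \<le> 2 * (\<epsilon> / 4) + (1 - \<beta>) ^ k + \<eta>) at_top"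
    obtain k where k: "(1 - \<beta>) ^ k < \<epsilon> / 4"
      using real_arch_pow_inv[of "\<epsilon> / 4" "1 - \<beta>"] \<beta> assms by auto
    from *[OF assms(1-4) \<open>\<epsilon> / 4 > 0\<close>, of k] show ?thesis
    proof eventually_elim
      case (elim t)
      have "2 * (\<epsilon> / 4) + (1 - \<beta>) ^ k + \<epsilon> / 4 \<le> \<epsilon>" using k by simp
      then show ?case using elim by (meson order_trans)
    qed
  qed
qed

end

section \<open>Existence of an invariant law\<close>

context stable_kernels
begin

text \<open>The time may depend on the radius, so this is the closure of the union of the supports
  of the laws \<open>p t z\<close>.\<close>

definition reach :: "'a set" where
  "reach = {y. \<forall>\<rho>>0. \<exists>t\<ge>0. measure (p t z) (ball y \<rho>) > 0}"

lemma z_in_reach: "z \<in> reach"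
  unfolding reach_def by (auto intro!: exI[of _ 0] simp: p_zero)

text \<open>A point outside \<open>reach\<close> has a ball that is null for \<open>p t z\<close>.
  By the Lindelof property countably many such balls cover all these points.\<close>

lemma AE_reach:
  assumes t: "t \<ge> 0"
  shows "AE x in p t z. x \<in> reach"
proof -
  interpret prob_space "p t z" by (rule prob_p) fact
  define \<B> where "\<B> = {ball y \<rho> | y \<rho>. \<rho> > 0 \<and> measure (p t z) (ball y \<rho>) = 0}"
  have "\<And>S. S \<in> \<B> \<Longrightarrow> open S" by (auto simp: \<B>_def)
  then obtain \<C> where \<C>: "\<C> \<subseteq> \<B>" "countable \<C>" "\<Union>\<C> = \<Union>\<B>"
    using Lindelof[of \<B>] by blast
  have "AE x in p t z. \<forall>C\<in>\<C>. x \<notin> C"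
  proof (rule AE_ball_countable[THEN iffD2])
    show "\<forall>C\<in>\<C>. AE x in p t z. x \<notin> C"
    proof
      fix C assume "C \<in> \<C>"
      then have "C \<in> null_sets (p t z)" using \<C>(1)
        by (auto simp: \<B>_def null_sets_def emeasure_eq_measure)
      then show "AE x in p t z. x \<notin> C" by (rule AE_not_in)
    qed
  qed (rule \<C>(2))
  then show ?thesis
  proof eventually_elim
    case (elim x)
    show ?case
    proof (rule ccontr)
      assume "x \<notin> reach"
      then obtain \<rho> where \<rho>: "\<rho> > 0" "measure (p t z) (ball x \<rho>) \<le> 0"
        using t unfolding reach_def by (auto simp: not_less)
      then have "measure (p t z) (ball x \<rho>) = 0" by (auto intro: antisym)
      with \<rho>(1) have "x \<in> \<Union>\<B>" unfolding \<B>_def by force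
      with \<C>(3) elim show False by auto
    qed
  qed
qed

text \<open>By the Feller property, the positive chance of hitting the ball after time
  \<open>u\<close> persists for starting points near \<open>z\<close>. By the lower bound condition
  the process from \<open>z\<close> is near \<open>z\<close> at every late time with probability at
  least \<alpha>, and the two chances multiply.\<close>

lemma reachable_ball_lower_bound:
  assumes y: "y \<in> reach" and \<rho>: "\<rho> > 0"
  obtains \<delta> where "\<delta> > 0" "eventually (\<lambda>t. measure (p t z) (ball y \<rho>) \<ge> \<delta>) at_top"
proof -
  obtain u where u: "u \<ge> 0" "measure (p u z) (ball y \<rho>) > 0"
    using y \<rho> unfolding reach_def by auto
  \<comment> \<open>A bounded continuous function that is positive exactly on the ball; the Feller
    property applies to it but not to the indicator.\<close>
  define f where "f = (\<lambda>x. max 0 (\<rho> - dist x y))"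
  have f: "0 \<le> f x" "f x \<le> \<rho> * indicator (ball y \<rho>) x" "f x \<le> \<rho>" for x
    using \<rho> by (auto simp: f_def indicator_def dist_commute)
  have fc: "continuous_on UNIV f" unfolding f_def by (intro continuous_intros)
  then have [measurable]: "f \<in> borel_measurable borel" by (rule borel_measurable_continuous_onI)
  have fi: "integrable (p u x) f" for x
  proof -
    interpret prob_space "p u x" by (rule prob_p) (rule u)
    have "f \<in> borel_measurable (p u x)"
      using \<open>f \<in> borel_measurable borel\<close> by (simp cong: measurable_cong_sets)
    then show ?thesis using f by (intro integrable_const_bound[where B=\<rho>]) auto
  qed
  have le: "(\<integral>w. f w \<partial>p u x) \<le> \<rho> * measure (p u x) (ball y \<rho>)" for x
  proof -
    interpret prob_space "p u x" by (rule prob_p) (rule u)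
    have "(\<integral>w. f w \<partial>p u x) \<le> (\<integral>w. \<rho> * indicator (ball y \<rho>) w \<partial>p u x)"
      by (intro integral_mono fi f integrable_mult_right integrable_real_indicator) (auto simp: emeasure_eq_measure)
    then show ?thesis by simp
  qed
  define \<gamma> where "\<gamma> = (\<integral>w. f w \<partial>p u z)"
  have \<gamma>: "\<gamma> > 0"
  proof (rule ccontr)
    assume "\<not> \<gamma> > 0"
    moreover have "\<gamma> \<ge> 0" unfolding \<gamma>_def using f by (intro Bochner_Integration.integral_nonneg) auto
    ultimately have "\<gamma> = 0" by simp
    then have "AE w in p u z. f w = 0"
      unfolding \<gamma>_def using integral_nonneg_eq_0_iff_AE[OF fi] f(1) by auto
    then have "AE w in p u z. w \<notin> ball y \<rho>"
      by eventually_elim (auto simp: f_def dist_commute)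
    then have "emeasure (p u z) (ball y \<rho>) = 0"
      using AE_iff_measurable[of "ball y \<rho>" "p u z" "\<lambda>w. w \<notin> ball y \<rho>"] by (auto simp: ball_def)
    with u show False by (simp add: measure_def)
  qed
  have "bounded (range f)" using f by (intro boundedI[where B=\<rho>]) auto
  from feller_p[OF u(1) fc this] have "isCont (\<lambda>x. \<integral>w. f w \<partial>p u x) z"
    by (simp add: continuous_on_eq_continuous_at)
  then have "eventually (\<lambda>x. (\<integral>w. f w \<partial>p u x) > \<gamma> / 2) (nhds z)"
    using \<gamma> unfolding isCont_def \<gamma>_def
    by (intro order_tendstoD(1)[OF tendsto_at_iff_tendsto_nhds[THEN iffD1]]) auto
  then obtain r where r: "r > 0" "\<And>x. x \<in> ball z r \<Longrightarrow> (\<integral>w. f w \<partial>p u x) > \<gamma> / 2"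
    by (auto simp: eventually_nhds_metric dist_commute)
  obtain \<alpha> where \<alpha>: "\<alpha> > 0" "\<And>x. eventually (\<lambda>t. measure (p t x) (ball z r) \<ge> \<alpha>) at_top"
    using lower_bound[OF r(1)] by blast
  \<comment> \<open>Near \<open>z\<close> the integral of \<open>f\<close> stays above
    \<open>\<gamma> / 2\<close>, and \<open>f\<close> is at most \<rho> times the indicator of the
    ball.\<close>
  define c where "c = \<gamma> / (2 * \<rho>)"
  have c: "c > 0" using \<gamma> \<rho> by (simp add: c_def)
  have pc: "measure (p u x) (ball y \<rho>) \<ge> c" if "x \<in> ball z r" for x
    using r(2)[OF that] le[of x] \<rho> by (simp add: c_def field_simps)
  have "eventually (\<lambda>t. measure (p (t + u) z) (ball y \<rho>) \<ge> c * \<alpha>) at_top"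
    using \<alpha>(2)[of z] eventually_ge_at_top[of 0]
  proof eventually_elim
    case (elim t)
    interpret prob_space "p t z" by (rule prob_p) (rule elim)
    have "c * \<alpha> \<le> c * measure (p t z) (ball z r)"
      using c elim by simp
    also have "\<dots> = (\<integral>x. c * indicator (ball z r) x \<partial>p t z)" by simp
    also have "\<dots> \<le> (\<integral>x. measure (p u x) (ball y \<rho>) \<partial>p t z)"
      using pc integrable_measure_p[OF prob_p[OF elim(2)] sets_p u(1)]
      by (intro integral_mono integrable_mult_right integrable_real_indicator)
        (auto simp: emeasure_eq_measure indicator_def)
    also have "\<dots> = measure (p (t + u) z) (ball y \<rho>)"
      using elim u by (simp add: chapman_kolmogorov)
    finally show ?case .
  qed
  then have "eventually (\<lambda>t. measure (p t z) (ball y \<rho>) \<ge> c * \<alpha>) at_top"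
    by (rule eventually_at_top_shiftD)
  with that[of "c * \<alpha>"] c \<alpha> show thesis by simp
qed

text \<open>The time at which the law of the process from x is close to that from z depends on x.
  By Baire's theorem, applied in the closure of the set of points reachable from z, this time can
  be chosen uniformly on a ball that is charged by the process from z.\<close>

lemma uniform_lower_bound:
  obtains \<delta> s where "\<delta> > 0" "s \<ge> 0"
    "\<And>A. A \<in> sets borel \<Longrightarrow> measure (p s z) A \<ge> 3 / 4 \<Longrightarrow>
      eventually (\<lambda>t. measure (p t z) A \<ge> \<delta>) at_top"
proof -
  define BL where "BL = {f::'a \<Rightarrow> real. f \<in> bounded_lipschitz \<and> (\<forall>x. \<bar>f x\<bar> \<le> 1)}"
  define B where "B = (\<lambda>n::nat. {x. \<forall>f\<in>BL. \<bar>(\<integral>y. f y \<partial>p n x) - (\<integral>y. f y \<partial>p n z)\<bar> \<le> 1/4})"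
  have "(1/4::real) > 0" by simp
  from eventually_continuous[OF this] obtain r where r0: "r > 0" "\<forall>x\<in>ball z r. eventually (\<lambda>t. \<forall>f\<in>bounded_lipschitz.
      (\<forall>x. \<bar>f x\<bar> \<le> 1) \<longrightarrow> \<bar>(\<integral>y. f y \<partial>p t x) - (\<integral>y. f y \<partial>p t z)\<bar> \<le> 1/4) at_top"
    by blast
  have r: "r > 0" "\<And>x. x \<in> ball z r \<Longrightarrow>
     eventually (\<lambda>t. \<forall>f\<in>BL. \<bar>(\<integral>y. f y \<partial>p t x) - (\<integral>y. f y \<partial>p t z)\<bar> \<le> 1/4) at_top"
    by (rule r0(1)) (rule eventually_mono[OF bspec[OF r0(2)]], auto simp: BL_def)
  \<comment> \<open>By the Feller property each test function contributes a closed condition, and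
    closedness survives the intersection over uncountably many of them.\<close>
  have closed_B: "closed (B n)" for n
  proof -
    have "B n = (\<Inter>f\<in>BL. {x. \<bar>(\<integral>y. f y \<partial>p n x) - (\<integral>y. f y \<partial>p n z)\<bar> \<le> 1/4})"
      by (auto simp: B_def)
    moreover have "closed {x. \<bar>(\<integral>y. f y \<partial>p n x) - (\<integral>y. f y \<partial>p n z)\<bar> \<le> 1/4}" if fBL: "f \<in> BL" for f
    proof -
      obtain l where l: "\<And>x y. \<bar>f x - f y\<bar> \<le> l * dist x y" and b: "bounded (range f)"
        using fBL unfolding BL_def bounded_lipschitz_def by blast
      have "continuous_on UNIV f"
      proof (rule lipschitz_on_continuous_on)
        show "(max 0 l)-lipschitz_on UNIV f"
        proof (rule lipschitz_onI)
          fix x y :: 'a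
          have "l * dist x y \<le> max 0 l * dist x y" by (intro mult_right_mono) auto
          then show "dist (f x) (f y) \<le> max 0 l * dist x y"
            using l[of x y] by (simp add: dist_real_def)
        qed auto
      qed
      then have "continuous_on UNIV (\<lambda>x. \<integral>y. f y \<partial>p n x)"
        using b by (intro feller_p) auto
      then show ?thesis by (intro closed_Collect_le continuous_intros)
    qed
    ultimately show ?thesis by auto
  qed
  \<comment> \<open>The radius is halved so that the closure still lies in \<open>ball z r\<close>,
    where eventual continuity is available.\<close>
  define S where "S = closure (reach \<inter> ball z (r / 2))"
  have S_cover: "S \<subseteq> (\<Union>n. B n)"
  proof
    fix x assume "x \<in> S"
    then have "x \<in> closure (ball z (r / 2))"
      unfolding S_def using closure_mono[of "reach \<inter> ball z (r / 2)" "ball z (r / 2)"] by auto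
    then have "x \<in> cball z (r / 2)" using closure_minimal[OF ball_subset_cball closed_cball] by blast
    then have "x \<in> ball z r" using r(1) by auto
    then obtain t0 where "\<And>t. t \<ge> t0 \<Longrightarrow> \<forall>f\<in>BL. \<bar>(\<integral>y. f y \<partial>p t x) - (\<integral>y. f y \<partial>p t z)\<bar> \<le> 1/4"
      using r(2) by (auto simp: eventually_at_top_linorder)
    \<comment> \<open>Closeness at all late times gives closeness at some integer time, so countably
      many sets suffice for the cover.\<close>
    then have "x \<in> B (nat \<lceil>t0\<rceil>)" unfolding B_def using real_nat_ceiling_ge by blast
    then show "x \<in> (\<Union>n. B n)" by auto
  qed
  have S_ne: "S \<noteq> {}" unfolding S_def using z_in_reach r(1) closure_subset by fastforce
  have S_closed: "closed S" by (simp add: S_def)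
  obtain n W where W: "open W" "W \<inter> S \<noteq> {}" "W \<inter> S \<subseteq> B n"
    by (rule Baire_closed_cover_interior[OF S_closed S_ne closed_B S_cover]) blast
  \<comment> \<open>An open set that meets a closure meets the set itself, so the ball chosen below
    can be centred at a point of \<open>reach\<close>.\<close>
  then have "W \<inter> (reach \<inter> ball z (r / 2)) \<noteq> {}"
    unfolding S_def using open_Int_closure_eq_empty by blast
  then obtain y where y: "y \<in> W" "y \<in> reach" "y \<in> ball z (r / 2)" by auto
  have "open (W \<inter> ball z (r / 2))" using W(1) by auto
  then obtain \<rho> where \<rho>: "\<rho> > 0" "ball y \<rho> \<subseteq> W \<inter> ball z (r / 2)"
    using y by (meson IntI open_contains_ball)
  have sub: "ball y \<rho> \<inter> reach \<subseteq> B n"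
    using \<rho>(2) W(3) closure_subset[of "reach \<inter> ball z (r / 2)"] by (auto simp: S_def)
  obtain \<delta> where \<delta>: "\<delta> > 0" "eventually (\<lambda>t. measure (p t z) (ball y \<rho>) \<ge> \<delta>) at_top"
    using reachable_ball_lower_bound[OF y(2) \<rho>(1)] .
  show thesis
  \<comment> \<open>At late times the process from \<open>z\<close> is in
    \<open>ball y \<rho>\<close> with probability at least \<delta>; from almost every point there
    it is in \<open>A\<close> after time \<open>n\<close> with probability at least
    \<open>3/4 - 1/4 = 1/2\<close>.\<close>
  proof (rule that[of "\<delta> / 2" "real n"])
    fix A :: "'a set" assume A: "A \<in> sets borel" and big: "measure (p (real n) z) A \<ge> 3 / 4"
    have half: "measure (p n x) A \<ge> 1 / 2" if "x \<in> ball y \<rho> \<inter> reach" for x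
    proof -
      have "\<bar>measure (p n x) A - measure (p n z) A\<bar> \<le> 1/4"
        using sub that by (intro measure_diff_le_of_lipschitz prob_p A) (auto simp: B_def BL_def)
      with big show ?thesis by linarith
    qed
    have "eventually (\<lambda>t::real. measure (p (t + n) z) A \<ge> \<delta> / 2) at_top"
      using \<delta>(2) eventually_ge_at_top[of 0]
    proof eventually_elim
      case (elim t)
      interpret prob_space "p t z" by (rule prob_p) (rule elim)
      have "\<delta> / 2 \<le> (\<integral>x. 1/2 * indicator (ball y \<rho>) x \<partial>p t z)" using elim by simp
      also have "\<dots> \<le> (\<integral>x. measure (p n x) A \<partial>p t z)"
      proof (rule integral_mono_AE)
        show "integrable (p t z) (\<lambda>x. 1/2 * indicator (ball y \<rho>) x :: real)"
          by (intro integrable_mult_right integrable_real_indicator) (auto simp: emeasure_eq_measure)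
        show "integrable (p t z) (\<lambda>x. measure (p n x) A)"
          using A elim by (intro integrable_measure_p prob_p) auto
        show "AE x in p t z. 1/2 * indicator (ball y \<rho>) x \<le> measure (p n x) A"
          using AE_reach[OF elim(2)] by eventually_elim (use half in \<open>auto simp: indicator_def\<close>)
      qed
      also have "\<dots> = measure (p (t + n) z) A"
        using elim A by (simp add: chapman_kolmogorov)
      finally show ?case .
    qed
    then show "eventually (\<lambda>t. measure (p t z) A \<ge> \<delta> / 2) at_top"
      by (rule eventually_at_top_shiftD)
  qed (use \<delta> in auto)
qed

text \<open>Let \<open>c * \<mu>\<close> be the countably additive part of the cluster point
  \<open>L\<close>. Since \<open>L\<close> is invariant, \<open>c\<close> times the law at time
  \<open>u\<close> started from \<mu> is again a measure below \<open>L\<close>; maximality puts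
  that law below \<mu>, and equal total mass makes them equal.\<close>

theorem invariant_law_exists:
  obtains \<mu> where "prob_space \<mu>" "sets \<mu> = sets borel" "\<And>t A. t \<ge> 0 \<Longrightarrow> A \<in> sets borel \<Longrightarrow> law \<mu> t A = measure \<mu> A"
proof -
  have "eventually (\<lambda>t. \<forall>A. 0 \<le> measure (p t z) A \<and> measure (p t z) A \<le> 1) at_top"
    using eventually_ge_at_top[of 0] by eventually_elim (auto intro: measure_p_le_1)
  then obtain L G where G: "G \<noteq> bot" "G \<le> at_top" and L: "\<And>A. ((\<lambda>t. measure (p t z) A) \<longlongrightarrow> L A) G"
    using cluster_point_unit_cube[of "at_top :: real filter" "\<lambda>t A. measure (p t z) A"]
      trivial_limit_at_top_linorder by blast
  have evG: "eventually P G" if "eventually P at_top" for P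
    using that G(2) by (simp add: filter_leD)
  \<comment> \<open>The law from \<open>z\<close> at time \<open>s + t\<close> is the law at time
    \<open>t\<close> started from \<open>p s z\<close>, which merges with the law started from
    \<open>z\<close>. Hence shifting time does not change the limit.\<close>
  have shift: "((\<lambda>t. measure (p (s + t) z) A) \<longlongrightarrow> L A) G" if s: "s \<ge> 0" and A: "A \<in> sets borel" for s A
  proof -
    have "((\<lambda>t. measure (p (s + t) z) A - measure (p t z) A) \<longlongrightarrow> 0) G"
    proof (rule tendstoI)
      fix e :: real assume e: "e > 0"
      have "eventually (\<lambda>t. \<forall>A\<in>sets borel. \<bar>law (p s z) t A - law (return borel z) t A\<bar> \<le> e / 2) at_top"
        using s e by (intro laws_merge prob_p prob_space_return) auto
      then have "eventually (\<lambda>t. dist (measure (p (s + t) z) A - measure (p t z) A) 0 < e) at_top"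
        using eventually_ge_at_top[of 0]
      proof eventually_elim
        case (elim t)
        then have "\<bar>measure (p (s + t) z) A - measure (p t z) A\<bar> \<le> e / 2"
          using A s by (auto simp: law_p law_return)
        then show ?case using e by (simp add: dist_real_def)
      qed
      then show "eventually (\<lambda>t. dist (measure (p (s + t) z) A - measure (p t z) A) 0 < e) G" by (rule evG)
    qed
    from tendsto_add[OF this L[of A]] show ?thesis by simp
  qed
  obtain \<delta> s where \<delta>: "\<delta> > 0" "s \<ge> 0"
    "\<And>A. A \<in> sets borel \<Longrightarrow> measure (p s z) A \<ge> 3 / 4 \<Longrightarrow> eventually (\<lambda>t. measure (p t z) A \<ge> \<delta>) at_top"
    using uniform_lower_bound by blast
  have L_nonneg: "0 \<le> L A" for A
    using tendsto_lowerbound[OF L _ G(1), of 0] by auto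
  have L_add: "L (A \<union> B) = L A + L B" if "A \<in> sets borel" "B \<in> sets borel" "A \<inter> B = {}" for A B
  proof (rule tendsto_unique[OF G(1) L])
    have "eventually (\<lambda>t. measure (p t z) A + measure (p t z) B = measure (p t z) (A \<union> B)) at_top"
      using eventually_ge_at_top[of 0]
    proof eventually_elim
      case (elim t)
      interpret prob_space "p t z" by (rule prob_p) (rule elim)
      show ?case using that by (simp add: finite_measure_Union)
    qed
    from evG[OF this] tendsto_add[OF L[of A] L[of B]]
    show "((\<lambda>t. measure (p t z) (A \<union> B)) \<longlongrightarrow> L A + L B) G"
      by (rule Lim_transform_eventually[rotated])
  qed
  \<comment> \<open>The measure \<open>p s z\<close> is countably additive, so some
    \<open>A k\<close> has mass above \<open>3 / 4\<close> under it;
    \<open>uniform_lower_bound\<close> then gives \<delta> along the filter, hence in the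
    limit.\<close>
  have L_cont: "\<exists>k. L (A k) \<ge> \<delta>" if A: "range A \<subseteq> sets borel" "incseq A" "(\<Union>i. A i) = space (borel :: 'a measure)" for A :: "nat \<Rightarrow> 'a set"
  proof -
    interpret prob_space "p s z" by (rule prob_p) (rule \<delta>(2))
    have "(\<lambda>k. measure (p s z) (A k)) \<longlonglongrightarrow> measure (p s z) (\<Union>k. A k)"
      using A by (intro finite_Lim_measure_incseq) auto
    moreover have "measure (p s z) (\<Union>k. A k) = 1" using A(3) prob_space by simp
    ultimately have "eventually (\<lambda>k. measure (p s z) (A k) > 3 / 4) sequentially"
      by (intro order_tendstoD(1)) auto
    then obtain k where k: "measure (p s z) (A k) \<ge> 3 / 4"
      by (metis eventually_sequentially less_imp_le order_refl)
    have "eventually (\<lambda>t. measure (p t z) (A k) \<ge> \<delta>) G"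
      using A(1) k by (intro evG \<delta>(3)) auto
    then have "L (A k) \<ge> \<delta>" by (rule tendsto_lowerbound[OF L _ G(1)])
    then show ?thesis ..
  qed
  obtain \<mu> c where \<mu>: "c > 0" "prob_space \<mu>" "sets \<mu> = sets borel"
    and c_le: "\<And>A. A \<in> sets borel \<Longrightarrow> c * measure \<mu> A \<le> L A"
    and max: "\<And>m A. prob_space m \<Longrightarrow> sets m = sets borel \<Longrightarrow> (\<And>A. A \<in> sets borel \<Longrightarrow> c * measure m A \<le> L A) \<Longrightarrow>
       A \<in> sets borel \<Longrightarrow> measure m A \<le> measure \<mu> A"
    by (rule countably_additive_part[of "borel :: 'a measure" L \<delta>]) (use L_nonneg L_add \<delta>(1) L_cont in auto)
  interpret \<mu>: prob_space \<mu> by (rule \<mu>(2))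
  have [simp]: "space \<mu> = UNIV" using sets_eq_imp_space_eq[OF \<mu>(3)] by simp
  \<comment> \<open>Since \<open>L\<close> is only finitely additive, the integral of
    \<open>measure (p u x) A\<close> is replaced by a finite sum over its level sets
    \<open>E j\<close>. Such sums pass to the limit along \<open>G\<close>, and
    \<open>1 / k < e / c\<close> makes the error less than \<open>e\<close>.\<close>
  have le_law: "c * law \<mu> u A \<le> L A" if u: "u \<ge> 0" and A: "A \<in> sets borel" for u A
  proof (rule field_le_epsilon)
    fix e :: real assume "e > 0"
    then obtain k :: nat where k: "k > 0" "1 / k < e / c"
      using \<mu>(1) by (metis divide_pos_pos nat_approx_posE zero_less_Suc)
    define g where "g = (\<lambda>x. measure (p u x) A)"
    have g [measurable]: "g \<in> borel_measurable borel" unfolding g_def using measurable_p u A by auto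
    have g01: "0 \<le> g x \<and> g x \<le> 1" for x unfolding g_def using measure_p_le_1 u by auto
    define E where "E = (\<lambda>j::nat. {x. real j / k \<le> g x})"
    have E: "E j \<in> sets borel" for j unfolding E_def by measurable
    have "law \<mu> u A \<le> (\<Sum>j=1..k. measure \<mu> (E j)) / k + 1 / k"
      using \<mu>.integral_staircase(2)[of g k] g g01 k(1) \<mu>(3)
      by (simp add: law_def E_def g_def cong: measurable_cong_sets)
    then have "c * law \<mu> u A \<le> c * ((\<Sum>j=1..k. measure \<mu> (E j)) / k + 1 / k)"
      using \<mu>(1) by (intro mult_left_mono) auto
    also have "\<dots> = (\<Sum>j=1..k. c * measure \<mu> (E j)) / k + c * (1 / k)"
      by (simp add: algebra_simps sum_distrib_left)
    also have "\<dots> \<le> (\<Sum>j=1..k. L (E j)) / k + c * (e / c)"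
      using \<mu>(1) k c_le[OF E] by (intro add_mono divide_right_mono sum_mono mult_left_mono) auto
    also have "(\<Sum>j=1..k. L (E j)) / k \<le> L A"
    proof (rule tendsto_le[OF G(1)])
      show "((\<lambda>t. measure (p (u + t) z) A) \<longlongrightarrow> L A) G" by (rule shift[OF u A])
      show "((\<lambda>t. (\<Sum>j=1..k. measure (p t z) (E j)) / k) \<longlongrightarrow> (\<Sum>j=1..k. L (E j)) / k) G"
        by (intro tendsto_intros L) (use k in auto)
      have "eventually (\<lambda>t. (\<Sum>j=1..k. measure (p t z) (E j)) / k \<le> measure (p (u + t) z) A) at_top"
        using eventually_ge_at_top[of 0]
      proof eventually_elim
        case (elim t)
        interpret prob_space "p t z" by (rule prob_p) (rule elim)
        have "(\<Sum>j=1..k. measure (p t z) (E j)) / k \<le> (\<integral>x. g x \<partial>p t z)"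
          using integral_staircase(1)[of g k] g g01 k(1)
          by (simp add: E_def cong: measurable_cong_sets)
        also have "\<dots> = measure (p (t + u) z) A"
          using elim u A by (simp add: g_def chapman_kolmogorov)
        finally show ?case by (simp add: add.commute)
      qed
      then show "eventually (\<lambda>t. (\<Sum>j=1..k. measure (p t z) (E j)) / k \<le> measure (p (u + t) z) A) G"
        by (rule evG)
    qed
    finally show "c * law \<mu> u A \<le> L A + e" using \<mu>(1) by simp
  qed
  have "law \<mu> u A = measure \<mu> A" if u: "u \<ge> 0" and A: "A \<in> sets borel" for u A
  proof -
    note b = bind_p[OF \<mu>(2,3) u]
    interpret b: prob_space "\<mu> \<bind> p u" by (rule b(1))
    have sp: "space (\<mu> \<bind> p u) = UNIV" using sets_eq_imp_space_eq[OF b(2)] by simp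
    \<comment> \<open>Applied to \<open>A\<close> and to its complement, this gives equality, since
      both measures have total mass 1.\<close>
    have le: "measure (\<mu> \<bind> p u) A \<le> measure \<mu> A" if "A \<in> sets borel" for A
      using max[OF b(1,2) _ that] le_law[OF u] b(3) by simp
    have "measure (\<mu> \<bind> p u) (- A) = 1 - measure (\<mu> \<bind> p u) A"
      using b.prob_compl[of A] A b(2) sp by (simp add: Compl_eq_Diff_UNIV)
    moreover have "measure \<mu> (- A) = 1 - measure \<mu> A"
      using \<mu>.prob_compl[of A] A \<mu>(3) by (simp add: Compl_eq_Diff_UNIV)
    ultimately show ?thesis using le[of A] le[of "- A"] A b(3)[OF A] by auto
  qed
  with \<mu> that show thesis by blast
qed

end

section \<open>Convergence for uniformly integrable classes\<close>

text \<open>Truncating at level \<open>K\<close> changes \<open>f\<close> only where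
  \<open>V\<close> is at least \<open>K\<close>, and there by at most \<open>V\<close>. The same
  tail bound gives integrability, because the absolute value of \<open>f\<close> is at most
  \<open>K\<close> plus the tail of \<open>V\<close>.\<close>

lemma truncation_error:
  fixes f V :: "'a \<Rightarrow> real"
  assumes "finite_measure m" and [measurable]: "f \<in> borel_measurable m" "V \<in> borel_measurable m"
    and fV: "\<And>x. \<bar>f x\<bar> \<le> V x" and K: "K > 0" and \<epsilon>: "\<epsilon> \<ge> 0"
    and tail: "(\<integral>\<^sup>+x. ennreal (V x * indicator {x. K \<le> V x} x) \<partial>m) \<le> ennreal \<epsilon>"
  shows "integrable m f" "\<bar>(\<integral>x. f x \<partial>m) - (\<integral>x. max (- K) (min K (f x)) \<partial>m)\<bar> \<le> \<epsilon>"
proof -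
  interpret finite_measure m by fact
  define g where "g = (\<lambda>x. V x * indicator {x. K \<le> V x} x)"
  have V0: "0 \<le> V x" for x using fV[of x] by linarith
  have g0: "0 \<le> g x" for x by (simp add: g_def V0)
  have "g = (\<lambda>x. if K \<le> V x then V x else 0)" by (auto simp: g_def)
  then have [measurable]: "g \<in> borel_measurable m" by simp
  have ig: "integrable m g"
    using tail by (intro integrableI_nonneg) (auto simp: g_def V0 le_less_trans)
  have iK: "integrable m (\<lambda>x. K + g x)" using ig by simp
  have nK: "norm (f x) \<le> norm (K + g x)" for x
    using fV[of x] V0[of x] K by (auto simp: g_def indicator_def)
  show If: "integrable m f"
    using nK by (intro Bochner_Integration.integrable_bound[OF iK]) auto
  have It: "integrable m (\<lambda>x. max (- K) (min K (f x)))"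
    using K by (intro integrable_const_bound[where B=K]) auto
  have "\<bar>(\<integral>x. f x \<partial>m) - (\<integral>x. max (- K) (min K (f x)) \<partial>m)\<bar> = \<bar>\<integral>x. f x - max (- K) (min K (f x)) \<partial>m\<bar>"
    using If It by simp
  also have "\<dots> \<le> (\<integral>x. \<bar>f x - max (- K) (min K (f x))\<bar> \<partial>m)" by (rule integral_abs_bound)
  also have "\<dots> \<le> (\<integral>x. g x \<partial>m)"
  proof (rule integral_mono)
    show "\<bar>f x - max (- K) (min K (f x))\<bar> \<le> g x" for x
      using fV[of x] V0[of x] K by (auto simp: g_def indicator_def)
  qed (use If It ig in auto)
  also have "\<dots> \<le> \<epsilon>"
  proof -
    have "ennreal (\<integral>x. g x \<partial>m) = (\<integral>\<^sup>+x. ennreal (g x) \<partial>m)"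
      using ig g0 by (simp add: nn_integral_eq_integral)
    with tail have "ennreal (\<integral>x. g x \<partial>m) \<le> ennreal \<epsilon>" by (simp add: g_def)
    then show ?thesis using \<epsilon> by (simp add: ennreal_le_iff)
  qed
  finally show "\<bar>(\<integral>x. f x \<partial>m) - (\<integral>x. max (- K) (min K (f x)) \<partial>m)\<bar> \<le> \<epsilon>" .
qed

text \<open>The support is nonempty: if every point had a null ball, countably many of these would
  cover the space by the Lindelof property.\<close>

lemma prob_space_charges_balls:
  fixes \<mu> :: "'a::polish_space measure"
  assumes "prob_space \<mu>" "sets \<mu> = sets borel"
  shows "\<exists>z. \<forall>r>0. measure \<mu> (ball z r) > 0"
proof (rule ccontr)
  interpret prob_space \<mu> by fact
  assume "\<nexists>z. \<forall>r>0. measure \<mu> (ball z r) > 0"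
  then have "\<forall>z. \<exists>r>0. measure \<mu> (ball z r) = 0"
    by (metis measure_nonneg less_eq_real_def)
  then obtain r where r: "\<And>z. r z > 0" "\<And>z. measure \<mu> (ball z (r z)) = 0" by metis
  obtain \<C> where \<C>: "\<C> \<subseteq> range (\<lambda>z. ball z (r z))" "countable \<C>" "\<Union>\<C> = \<Union>(range (\<lambda>z. ball z (r z)))"
    using Lindelof[of "range (\<lambda>z. ball z (r z))"] by auto
  have "\<Union>\<C> = UNIV" unfolding \<C>(3) using r(1) by (auto intro: centre_in_ball[THEN iffD2])
  moreover have "\<Union>\<C> \<in> null_sets \<mu>"
  proof (rule null_sets_UN'[of \<C> "\<lambda>C. C", simplified])
    show "C \<in> null_sets \<mu>" if "C \<in> \<C>" for C
      using that \<C>(1) r(2) assms(2) by (auto simp: null_sets_def emeasure_eq_measure)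
  qed (use \<C>(2) in auto)
  moreover have "space \<mu> = UNIV" using sets_eq_imp_space_eq[OF assms(2)] by simp
  ultimately show False using emeasure_space_1 by (auto simp: null_sets_def)
qed

section \<open>Invariant laws and convergence to them\<close>

context feller_kernels
begin

lemma nn_integral_emeasure_p:
  assumes "prob_space \<mu>" "sets \<mu> = sets borel" "0 \<le> t" "A \<in> sets borel"
  shows "(\<integral>\<^sup>+x. emeasure (p t x) A \<partial>\<mu>) = ennreal (law \<mu> t A)"
proof -
  have "emeasure (p t x) A = ennreal (measure (p t x) A)" for x
    using prob_p[OF assms(3)] by (simp add: finite_measure.emeasure_eq_measure prob_space_def)
  then show ?thesis
    using integrable_measure_p[OF assms] by (simp add: law_def nn_integral_eq_integral)
qed

text \<open>The real-valued counterpart of \<open>invariant_prob\<close>; the two agree by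
  \<open>invariant_prob_iff_invariant_law\<close>.\<close>

definition invariant_law :: "'a measure \<Rightarrow> bool" where
  "invariant_law \<mu> \<longleftrightarrow> prob_space \<mu> \<and> sets \<mu> = sets borel \<and>
     (\<forall>t\<ge>0. \<forall>A\<in>sets borel. law \<mu> t A = measure \<mu> A)"

end

context stable_kernels
begin

text \<open>The law from \<open>x\<close> merges with the law started from \<mu>, and the latter
  does not move.\<close>

lemma converges_to_invariant_law:
  assumes "invariant_law \<mu>" "\<epsilon> > 0"
  shows "eventually (\<lambda>t. \<forall>A\<in>sets borel. \<bar>measure (p t x) A - measure \<mu> A\<bar> \<le> \<epsilon>) at_top"
proof -
  have "eventually (\<lambda>t. \<forall>A\<in>sets borel. \<bar>law (return borel x) t A - law \<mu> t A\<bar> \<le> \<epsilon>) at_top"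
    using assms by (intro laws_merge prob_space_return) (auto simp: invariant_law_def)
  then show ?thesis
    using eventually_ge_at_top[of 0]
    by eventually_elim (use assms in \<open>auto simp: law_return invariant_law_def\<close>)
qed

lemma invariant_law_ex1: "\<exists>!\<mu>. invariant_law \<mu>"
proof -
  have "\<exists>\<mu>. invariant_law \<mu>"
    using invariant_law_exists unfolding invariant_law_def by metis
  \<comment> \<open>Both are limits in total variation of the same laws
    \<open>p t z\<close>.\<close>
  moreover have "\<mu>1 = \<mu>2" if "invariant_law \<mu>1" "invariant_law \<mu>2" for \<mu>1 \<mu>2
  proof (rule measure_eqI)
    show s: "sets \<mu>1 = sets \<mu>2" using that by (simp add: invariant_law_def)
    fix A assume "A \<in> sets \<mu>1"
    then have A: "A \<in> sets borel" using that by (simp add: invariant_law_def)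
    have "\<bar>measure \<mu>1 A - measure \<mu>2 A\<bar> \<le> 0 + e" if "e > 0" for e
    proof -
      have e: "e / 2 > 0" using that by simp
      have "eventually (\<lambda>t. \<bar>measure \<mu>1 A - measure \<mu>2 A\<bar> \<le> e) (at_top :: real filter)"
        using converges_to_invariant_law[OF \<open>invariant_law \<mu>1\<close> e, of z]
          converges_to_invariant_law[OF \<open>invariant_law \<mu>2\<close> e, of z]
      proof eventually_elim
        case (elim t)
        then have "\<bar>measure (p t z) A - measure \<mu>1 A\<bar> \<le> e / 2" "\<bar>measure (p t z) A - measure \<mu>2 A\<bar> \<le> e / 2"
          using A by auto
        then show ?case by linarith
      qed
      then show ?thesis by simp
    qed
    then have "\<bar>measure \<mu>1 A - measure \<mu>2 A\<bar> \<le> 0" by (rule field_le_epsilon)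
    then have eq: "measure \<mu>1 A = measure \<mu>2 A" by simp
    interpret m1: prob_space \<mu>1 using that by (simp add: invariant_law_def)
    interpret m2: prob_space \<mu>2 using that by (simp add: invariant_law_def)
    show "emeasure \<mu>1 A = emeasure \<mu>2 A"
      by (simp add: eq m1.emeasure_eq_measure m2.emeasure_eq_measure)
  qed
  ultimately show ?thesis by blast
qed

lemma converges_to_invariant_law_integral:
  fixes K \<epsilon> :: real
  assumes \<mu>: "invariant_law \<mu>" and K: "K > 0" and "\<epsilon> > 0"
  shows "eventually (\<lambda>t. \<forall>g\<in>borel_measurable borel. (\<forall>x. \<bar>g x\<bar> \<le> K) \<longrightarrow>
    \<bar>(\<integral>y. g y \<partial>p t x) - (\<integral>y. g y \<partial>\<mu>)\<bar> \<le> \<epsilon>) at_top"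
proof -
  have m: "prob_space \<mu>" "sets \<mu> = sets borel" using \<mu> by (auto simp: invariant_law_def)
  have e: "\<epsilon> / (2 * K) > 0" using assms by simp
  from converges_to_invariant_law[OF \<mu> e, of x] eventually_ge_at_top[of 0] show ?thesis
  proof eventually_elim
    case (elim t)
    show ?case
    proof (intro ballI impI)
      fix g :: "'a \<Rightarrow> real" assume g: "g \<in> borel_measurable borel" "\<forall>x. \<bar>g x\<bar> \<le> K"
      have "\<bar>(\<integral>y. g y \<partial>p t x) - (\<integral>y. g y \<partial>\<mu>)\<bar> \<le> 2 * K * (\<epsilon> / (2 * K))"
        using elim g m K by (intro integral_diff_le_of_measure_diff) (auto intro: prob_p cong: measurable_cong_sets)
      then show "\<bar>(\<integral>y. g y \<partial>p t x) - (\<integral>y. g y \<partial>\<mu>)\<bar> \<le> \<epsilon>" using K by simp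
    qed
  qed
qed

text \<open>A Fatou-type argument: convergence to \<mu> handles the bounded truncations
  \<open>h L\<close>, and monotone convergence removes the truncation. It carries the uniform tail
  bound along the process over to the invariant law.\<close>

lemma invariant_law_tail:
  fixes g :: "'a \<Rightarrow> real"
  assumes \<mu>: "invariant_law \<mu>" and g: "g \<in> borel_measurable borel" "\<And>x. 0 \<le> g x" and \<epsilon>: "\<epsilon> \<ge> 0"
    and tail: "\<And>t. t \<ge> 0 \<Longrightarrow> (\<integral>\<^sup>+y. ennreal (g y) \<partial>p t x) \<le> ennreal \<epsilon>"
  shows "(\<integral>\<^sup>+y. ennreal (g y) \<partial>\<mu>) \<le> ennreal \<epsilon>"
proof -
  have m: "prob_space \<mu>" and sets_\<mu>: "sets \<mu> = sets borel" using \<mu> by (auto simp: invariant_law_def)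
  interpret prob_space \<mu> by (rule m)
  have [measurable]: "g \<in> borel_measurable \<mu>" using g(1) sets_\<mu> by (simp cong: measurable_cong_sets)
  \<comment> \<open>The level is \<open>Suc L\<close> so that it is positive for every
    \<open>L\<close>, as the convergence of bounded integrals requires.\<close>
  define h where "h = (\<lambda>(L::nat) y. min (g y) (real (Suc L)))"
  have h0: "0 \<le> h L y" "\<bar>h L y\<bar> \<le> real (Suc L)" "h L y \<le> g y" for L y
    using g(2)[of y] by (auto simp: h_def)
  have hm: "h L \<in> borel_measurable borel" for L unfolding h_def using g(1) by measurable
  have hm' [measurable]: "h L \<in> borel_measurable \<mu>" for L unfolding h_def by measurable
  have *: "(\<integral>\<^sup>+y. ennreal (h L y) \<partial>\<mu>) \<le> ennreal \<epsilon>" for L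
  proof -
    have ih: "integrable \<mu> (h L)"
      using h0[of L] by (intro integrable_const_bound[where B="real (Suc L)"]) auto
    have "(\<integral>y. h L y \<partial>\<mu>) \<le> \<epsilon>"
    proof (rule field_le_epsilon)
      fix e :: real assume "e > 0"
      have "real (Suc L) > 0" by simp
      from converges_to_invariant_law_integral[OF \<mu> this \<open>e > 0\<close>, of x] eventually_ge_at_top[of 0]
      have "eventually (\<lambda>t. (\<integral>y. h L y \<partial>\<mu>) \<le> \<epsilon> + e) (at_top :: real filter)"
      proof eventually_elim
        case (elim t)
        interpret P: prob_space "p t x" by (rule prob_p) (rule elim)
        have "h L \<in> borel_measurable (p t x)" using hm by (simp cong: measurable_cong_sets)
        then have i: "integrable (p t x) (h L)"
          using h0[of L] by (intro P.integrable_const_bound[where B="real (Suc L)"]) auto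
        have "ennreal (\<integral>y. h L y \<partial>p t x) = (\<integral>\<^sup>+y. ennreal (h L y) \<partial>p t x)"
          using i h0 by (simp add: nn_integral_eq_integral)
        also have "\<dots> \<le> (\<integral>\<^sup>+y. ennreal (g y) \<partial>p t x)"
          using h0 by (intro nn_integral_mono ennreal_leI) auto
        also have "\<dots> \<le> ennreal \<epsilon>" using tail elim by auto
        finally have "(\<integral>y. h L y \<partial>p t x) \<le> \<epsilon>" using \<epsilon> by (simp add: ennreal_le_iff)
        moreover have "\<bar>(\<integral>y. h L y \<partial>p t x) - (\<integral>y. h L y \<partial>\<mu>)\<bar> \<le> e"
          using elim hm h0 by blast
        ultimately show ?case by linarith
      qed
      then show "(\<integral>y. h L y \<partial>\<mu>) \<le> \<epsilon> + e" by simp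
    qed
    then show ?thesis using ih h0 by (simp add: nn_integral_eq_integral ennreal_leI)
  qed
  have "(SUP L. ennreal (h L y)) = ennreal (g y)" for y
  proof (rule SUP_eqI)
    show "ennreal (h L y) \<le> ennreal (g y)" for L using h0 by (simp add: ennreal_leI)
    fix b assume b: "\<And>L. L \<in> UNIV \<Longrightarrow> ennreal (h L y) \<le> b"
    obtain L :: nat where "g y \<le> real L" using real_arch_simple by blast
    then have "h L y = g y" by (simp add: h_def)
    with b[of L] show "ennreal (g y) \<le> b" by simp
  qed
  then have "(\<integral>\<^sup>+y. ennreal (g y) \<partial>\<mu>) = (\<integral>\<^sup>+y. (SUP L. ennreal (h L y)) \<partial>\<mu>)" by simp
  also have "\<dots> = (SUP L. \<integral>\<^sup>+y. ennreal (h L y) \<partial>\<mu>)"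
    by (intro nn_integral_monotone_convergence_SUP)
      (auto simp: incseq_def le_fun_def h_def intro!: ennreal_leI)
  also have "\<dots> \<le> ennreal \<epsilon>" using * by (intro SUP_least) auto
  finally show ?thesis .
qed

text \<open>The error splits into three parts of size \<open>\<epsilon> / 3\<close>: truncation
  under \<open>p t x\<close>, truncation under \<mu>, and the difference of the truncated integrals.
  The level \<open>K\<close> depends on \<open>x\<close> and \<epsilon> but not on \<open>f\<close>
  or \<open>t\<close>, so the convergence is uniform over \<open>F\<close>.\<close>

theorem uniformly_integrable_convergence:
  fixes F :: "('a \<Rightarrow> real) set" and V :: "'a \<Rightarrow> real" and \<epsilon> :: real
  assumes \<mu>: "invariant_law \<mu>"
    and V: "V \<in> borel_measurable borel" "\<And>y. 0 \<le> V y"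
    and ui: "\<And>x \<epsilon>. \<epsilon> > 0 \<Longrightarrow> \<exists>K>0. \<forall>t\<ge>0. (\<integral>\<^sup>+y. ennreal (V y * indicator {y. K \<le> V y} y) \<partial>p t x) \<le> ennreal \<epsilon>"
    and F: "F \<subseteq> borel_measurable borel" "\<And>f y. f \<in> F \<Longrightarrow> \<bar>f y\<bar> \<le> V y"
  shows "\<And>f. f \<in> F \<Longrightarrow> integrable \<mu> f"
    and "\<epsilon> > 0 \<Longrightarrow> eventually (\<lambda>t. \<forall>f\<in>F. \<bar>(\<integral>y. f y \<partial>p t x) - (\<integral>y. f y \<partial>\<mu>)\<bar> \<le> \<epsilon>) at_top"
proof -
  have m: "prob_space \<mu>" "sets \<mu> = sets borel" using \<mu> by (auto simp: invariant_law_def)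
  have fin: "finite_measure \<mu>" using m(1) by (simp add: prob_space_def)
  have meas: "g \<in> borel_measurable \<mu>" if "g \<in> borel_measurable borel" for g :: "'a \<Rightarrow> real"
    using that m(2) by (simp cong: measurable_cong_sets)
  have meas_p: "g \<in> borel_measurable (p t x)" if "g \<in> borel_measurable borel" for g :: "'a \<Rightarrow> real" and t x
    using that by (simp cong: measurable_cong_sets)
  have tail: "(\<integral>\<^sup>+y. ennreal (V y * indicator {y. K \<le> V y} y) \<partial>\<mu>) \<le> ennreal e"
    if "e > 0" "\<forall>t\<ge>0. (\<integral>\<^sup>+y. ennreal (V y * indicator {y. K \<le> V y} y) \<partial>p t x) \<le> ennreal e" for K e x
  proof (rule invariant_law_tail[OF \<mu>])
    show "(\<lambda>y. V y * indicator {y. K \<le> V y} y) \<in> borel_measurable borel" using V(1) by measurable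
  qed (use that V in auto)
  show "integrable \<mu> f" if f: "f \<in> F" for f
  proof -
    obtain K where K: "K > 0" "\<forall>t\<ge>0. (\<integral>\<^sup>+y. ennreal (V y * indicator {y. K \<le> V y} y) \<partial>p t z) \<le> ennreal 1"
      using ui[of 1 z] by auto
    have "f \<in> borel_measurable borel" using f F by auto
    from truncation_error(1)[OF fin meas[OF this] meas[OF V(1)] F(2)[OF f] K(1) _ tail[OF _ K(2)]]
    show ?thesis by simp
  qed
  assume \<epsilon>: "\<epsilon> > 0"
  then have e: "\<epsilon> / 3 > 0" by simp
  obtain K where K: "K > 0" "\<forall>t\<ge>0. (\<integral>\<^sup>+y. ennreal (V y * indicator {y. K \<le> V y} y) \<partial>p t x) \<le> ennreal (\<epsilon> / 3)"
    using ui[OF e, of x] by auto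
  from converges_to_invariant_law_integral[OF \<mu> K(1) e, of x] eventually_ge_at_top[of 0]
  show "eventually (\<lambda>t. \<forall>f\<in>F. \<bar>(\<integral>y. f y \<partial>p t x) - (\<integral>y. f y \<partial>\<mu>)\<bar> \<le> \<epsilon>) at_top"
  proof eventually_elim
    case (elim t)
    show ?case
    proof
      fix f assume f: "f \<in> F"
      then have fm [measurable]: "f \<in> borel_measurable borel" using F by auto
      have finp: "finite_measure (p t x)" using prob_p[OF elim(2)] by (simp add: prob_space_def)
      have "\<bar>(\<integral>y. f y \<partial>p t x) - (\<integral>y. max (- K) (min K (f y)) \<partial>p t x)\<bar> \<le> \<epsilon> / 3"
        using truncation_error(2)[OF finp meas_p[OF fm] meas_p[OF V(1)] F(2)[OF f] K(1) _ K(2)[rule_format, OF elim(2)]] e by simp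
      moreover have "\<bar>(\<integral>y. f y \<partial>\<mu>) - (\<integral>y. max (- K) (min K (f y)) \<partial>\<mu>)\<bar> \<le> \<epsilon> / 3"
        using truncation_error(2)[OF fin meas[OF fm] meas[OF V(1)] F(2)[OF f] K(1) _ tail[OF e K(2)]] e by simp
      moreover have "(\<lambda>y. max (- K) (min K (f y))) \<in> borel_measurable borel" by measurable
      then have "\<bar>(\<integral>y. max (- K) (min K (f y)) \<partial>p t x) - (\<integral>y. max (- K) (min K (f y)) \<partial>\<mu>)\<bar> \<le> \<epsilon> / 3"
        using elim(1) K(1) by (auto dest!: bspec)
      ultimately show "\<bar>(\<integral>y. f y \<partial>p t x) - (\<integral>y. f y \<partial>\<mu>)\<bar> \<le> \<epsilon>" by linarith
    qed
  qed
qed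

end

section \<open>The Markov family\<close>

lemma markov_family_measurable:
  assumes "markov_family M Px X" "0 \<le> t"
  shows "X t \<in> Px x \<rightarrow>\<^sub>M borel"
proof -
  have "sets (Px x) = sets M" "X t \<in> M \<rightarrow>\<^sub>M borel"
    using assms by (simp_all add: markov_family_def)
  then show ?thesis using measurable_cong_sets[of "Px x" M borel borel] by simp
qed

lemma cadlag_feller_markov_feller_kernels:
  fixes Px :: "'a::polish_space \<Rightarrow> 'w measure"
  assumes "cadlag_feller_markov M Px X"
  shows "feller_kernels (trans_kernel Px X)"
proof -
  from assms have mf: "markov_family M Px X" and fe: "feller Px X"
    by (auto simp: cadlag_feller_markov_def)
  have prob: "prob_space (Px x)" and sets_Px: "sets (Px x) = sets M" for x
    using mf by (auto simp: markov_family_def)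
  have space_Px: "space (Px x) = space M" for x using sets_eq_imp_space_eq[OF sets_Px] .
  have X: "X t \<in> Px x \<rightarrow>\<^sub>M borel" if "0 \<le> t" for t x
    by (rule markov_family_measurable[OF mf that])
  have measure_eq: "measure (trans_kernel Px X t x) A = measure (Px x) (X t -` A \<inter> space M)"
    if "0 \<le> t" "A \<in> sets borel" for t x A
    unfolding trans_kernel_def using that by (simp add: measure_distr[OF X] space_Px)
  have Pt_indicator: "Pt Px X t (indicator A) x = measure (trans_kernel Px X t x) A"
    if "A \<in> sets borel" for t x A
    using that by (simp add: Pt_def trans_kernel_def)
  show ?thesis
  proof (rule feller_kernels.intro)
    show "prob_space (trans_kernel Px X t x)" if "0 \<le> t" for t x
      unfolding trans_kernel_def by (rule prob_space.prob_space_distr[OF prob X[OF that]])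
    show "sets (trans_kernel Px X t x) = sets borel" for t x by (simp add: trans_kernel_def)
    show meas: "(\<lambda>x. measure (trans_kernel Px X t x) A) \<in> borel_measurable borel"
      if "0 \<le> t" "A \<in> sets borel" for t A
      using mf that unfolding measure_eq[OF that] markov_family_def by blast
    show "measure (trans_kernel Px X 0 x) A = indicator A x" if A: "A \<in> sets borel" for x A
    proof -
      interpret prob_space "Px x" by (rule prob)
      have "AE \<omega> in Px x. X 0 \<omega> = x" using mf by (simp add: markov_family_def)
      then have "AE \<omega> in Px x. indicator A (X 0 \<omega>) = (indicator A x :: real)" by eventually_elim simp
      then have "(\<integral>\<omega>. indicator A (X 0 \<omega>) \<partial>Px x) = (\<integral>\<omega>. indicator A x \<partial>Px x :: real)"
        using A X[of 0 x] by (intro integral_cong_AE) auto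
      moreover have "(\<integral>\<omega>. indicator A (X 0 \<omega>) \<partial>Px x :: real) = (\<integral>y. indicator A y \<partial>trans_kernel Px X 0 x)"
        unfolding trans_kernel_def using A X[of 0 x] by (subst integral_distr) auto
      ultimately show ?thesis using A by (simp add: prob_space trans_kernel_def)
    qed
    show "measure (trans_kernel Px X (s + t) x) A = (\<integral>y. measure (trans_kernel Px X t y) A \<partial>trans_kernel Px X s x)"
      if st: "0 \<le> s" "0 \<le> t" and A: "A \<in> sets borel" for s t A x
    proof -
      \<comment> \<open>The Markov property with the constant 1 as the function of the past and an
        indicator as the function of the future is the Chapman-Kolmogorov equation.\<close>
      have "bounded (range (indicator A :: 'a \<Rightarrow> real))"
        by (rule boundedI[where B=1]) (auto simp: indicator_def)
      moreover have "bounded (range (\<lambda>_::'w. 1::real))" by simp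
      moreover have "(\<lambda>_. 1::real) \<in> borel_measurable (nat_filt M X s)" by simp
      moreover have "(indicator A :: 'a \<Rightarrow> real) \<in> borel_measurable borel" using A by simp
      ultimately have "(\<integral>\<omega>. 1 * indicator A (X (s + t) \<omega>) \<partial>Px x) = (\<integral>\<omega>. 1 * Pt Px X t (indicator A) (X s \<omega>) \<partial>Px x)"
        using mf st unfolding markov_family_def by blast
      then have "(\<integral>\<omega>. indicator A (X (s + t) \<omega>) \<partial>Px x) = (\<integral>\<omega>. measure (trans_kernel Px X t (X s \<omega>)) A \<partial>Px x)"
        using A by (simp add: Pt_indicator)
      also have "\<dots> = (\<integral>y. measure (trans_kernel Px X t y) A \<partial>trans_kernel Px X s x)"
        unfolding trans_kernel_def[of Px X s] by (rule integral_distr[symmetric, OF X meas]) (use st A in auto)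
      also have "(\<integral>\<omega>. indicator A (X (s + t) \<omega>) \<partial>Px x :: real) = (\<integral>y. indicator A y \<partial>trans_kernel Px X (s + t) x)"
        unfolding trans_kernel_def using A X[of "s + t" x] st by (subst integral_distr) auto
      finally show ?thesis using A by (simp add: trans_kernel_def)
    qed
    show "continuous_on UNIV (\<lambda>x. \<integral>y. f y \<partial>trans_kernel Px X t x)"
      if "0 \<le> t" "continuous_on UNIV f" "bounded (range f)" for t and f :: "'a \<Rightarrow> real"
    proof -
      have "continuous_on UNIV (Pt Px X t f)" using fe that unfolding feller_def by blast
      moreover have "Pt Px X t f = (\<lambda>x. \<integral>y. f y \<partial>trans_kernel Px X t x)" by (simp add: fun_eq_iff Pt_def)
      ultimately show ?thesis by simp
    qed
  qed
qed

text \<open>A change of variables along \<open>X t\<close> turns uniform integrability of the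
  process into a tail bound for the kernels. The class \<open>F\<close> is nonempty so that
  \<open>V\<close> dominates the absolute value of some function and is thus nonnegative.\<close>

lemma hyp_H2_tail:
  fixes Px :: "'a::polish_space \<Rightarrow> 'w measure"
  assumes "cadlag_feller_markov M Px X" "hyp_H2 M Px X F" "F \<noteq> {}"
  shows "\<exists>V\<in>classA Px X. (\<forall>y. 0 \<le> V y) \<and> (\<forall>f\<in>F. \<forall>y. \<bar>f y\<bar> \<le> V y) \<and>
    (\<forall>x. \<forall>\<epsilon>>0. \<exists>K>0. \<forall>t\<ge>0.
      (\<integral>\<^sup>+y. ennreal (V y * indicator {y. K \<le> V y} y) \<partial>trans_kernel Px X t x) \<le> ennreal \<epsilon>)"
proof -
  from assms(1) have mf: "markov_family M Px X" by (simp add: cadlag_feller_markov_def)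
  have sets_Px: "sets (Px x) = sets M" for x
    using mf by (auto simp: markov_family_def)
  have space_Px: "space (Px x) = space M" for x using sets_eq_imp_space_eq[OF sets_Px] .
  have X: "X t \<in> Px x \<rightarrow>\<^sub>M borel" if "0 \<le> t" for t x
    by (rule markov_family_measurable[OF mf that])
  obtain V where V: "V \<in> classA Px X" "\<And>f x. f \<in> F \<Longrightarrow> \<bar>f x\<bar> \<le> V x"
    and ui: "\<And>x. ((\<lambda>K. SUP t\<in>{0..}. \<integral>\<^sup>+\<omega>. ennreal (\<bar>V (X t \<omega>)\<bar> *
              indicator {\<omega>\<in>space M. K \<le> \<bar>V (X t \<omega>)\<bar>} \<omega>) \<partial>Px x) \<longlongrightarrow> 0) at_top"
    using assms(2) unfolding hyp_H2_def by blast
  have Vm: "V \<in> borel_measurable borel" using V(1) by (simp add: classA_def)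
  obtain f0 where "f0 \<in> F" using assms(3) by auto
  then have V0: "0 \<le> V y" for y using V(2)[of f0 y] by linarith
  have tail: "\<exists>K>0. \<forall>t\<ge>0. (\<integral>\<^sup>+y. ennreal (V y * indicator {y. K \<le> V y} y) \<partial>trans_kernel Px X t x) \<le> ennreal \<epsilon>"
    if "\<epsilon> > 0" for x \<epsilon>
  proof -
    have "eventually (\<lambda>K. (SUP t\<in>{0..}. \<integral>\<^sup>+\<omega>. ennreal (\<bar>V (X t \<omega>)\<bar> *
        indicator {\<omega>\<in>space M. K \<le> \<bar>V (X t \<omega>)\<bar>} \<omega>) \<partial>Px x) < ennreal \<epsilon>) at_top"
      using that by (intro order_tendstoD(2)[OF ui]) simp
    then have "eventually (\<lambda>K. K > 0 \<and> (SUP t\<in>{0..}. \<integral>\<^sup>+\<omega>. ennreal (\<bar>V (X t \<omega>)\<bar> *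
        indicator {\<omega>\<in>space M. K \<le> \<bar>V (X t \<omega>)\<bar>} \<omega>) \<partial>Px x) < ennreal \<epsilon>) at_top"
      using eventually_gt_at_top[of 0] by eventually_elim simp
    then obtain K where K: "K > 0" "(SUP t\<in>{0..}. \<integral>\<^sup>+\<omega>. ennreal (\<bar>V (X t \<omega>)\<bar> *
        indicator {\<omega>\<in>space M. K \<le> \<bar>V (X t \<omega>)\<bar>} \<omega>) \<partial>Px x) < ennreal \<epsilon>"
      unfolding eventually_at_top_linorder by blast
    have gm: "(\<lambda>y. ennreal (V y * indicator {y. K \<le> V y} y)) \<in> borel_measurable borel"
      using Vm by measurable
    have "(\<integral>\<^sup>+y. ennreal (V y * indicator {y. K \<le> V y} y) \<partial>trans_kernel Px X t x) \<le> ennreal \<epsilon>" if t: "t \<ge> 0" for t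
    proof -
      have "(\<integral>\<^sup>+y. ennreal (V y * indicator {y. K \<le> V y} y) \<partial>trans_kernel Px X t x)
          = (\<integral>\<^sup>+\<omega>. ennreal (V (X t \<omega>) * indicator {y. K \<le> V y} (X t \<omega>)) \<partial>Px x)"
        unfolding trans_kernel_def by (rule nn_integral_distr[OF X[OF t]]) (simp add: gm)
      also have "\<dots> = (\<integral>\<^sup>+\<omega>. ennreal (\<bar>V (X t \<omega>)\<bar> * indicator {\<omega>\<in>space M. K \<le> \<bar>V (X t \<omega>)\<bar>} \<omega>) \<partial>Px x)"
        using V0 by (intro nn_integral_cong) (simp add: space_Px indicator_def)
      also have "\<dots> \<le> (SUP t\<in>{0..}. \<integral>\<^sup>+\<omega>. ennreal (\<bar>V (X t \<omega>)\<bar> *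
          indicator {\<omega>\<in>space M. K \<le> \<bar>V (X t \<omega>)\<bar>} \<omega>) \<partial>Px x)"
        using t by (intro SUP_upper) auto
      finally show ?thesis using K(2) by (meson less_imp_le order_trans)
    qed
    with K(1) show ?thesis by blast
  qed
  show ?thesis using V(1) V0 V(2) tail by (intro bexI[of _ V]) simp_all
qed

section \<open>Passage between the conditions on the process and those on its kernels\<close>

lemma zero_in_unit_bounded_lipschitz: "(\<lambda>_. 0) \<in> {f \<in> bounded_lipschitz. \<forall>x. \<bar>f x\<bar> \<le> 1}"
  unfolding bounded_lipschitz_def by (auto intro: exI[of _ 0])

lemma unif_ev_cont_cond_C1_stable_kernels:
  fixes Px :: "'a::polish_space \<Rightarrow> 'w measure"
  assumes "cadlag_feller_markov M Px X" and F: "{f \<in> bounded_lipschitz. \<forall>x. \<bar>f x\<bar> \<le> 1} \<subseteq> F"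
    and ec: "unif_ev_cont Px X F z" and c1: "cond_C1 Px X z"
  shows "stable_kernels (trans_kernel Px X) z"
proof -
  interpret feller_kernels "trans_kernel Px X"
    by (rule cadlag_feller_markov_feller_kernels) fact
  show ?thesis
  proof (intro stable_kernels.intro stable_kernels_axioms.intro feller_kernels_axioms)
    fix \<epsilon> :: real assume \<epsilon>: "\<epsilon> > 0"
    \<comment> \<open>Half of \<epsilon> makes the upper limit strictly smaller than \<epsilon>,
      which is what yields an eventual inequality.\<close>
    obtain \<delta> where \<delta>: "\<delta> > 0" "\<And>x'. dist x' z < \<delta> \<Longrightarrow>
        Limsup at_top (\<lambda>t. SUP f\<in>F. ereal \<bar>Pt Px X t f x' - Pt Px X t f z\<bar>) \<le> ereal (\<epsilon> / 2)"
      using ec half_gt_zero[OF \<epsilon>] unfolding unif_ev_cont_def by blast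
    have "eventually (\<lambda>t. \<forall>f\<in>bounded_lipschitz. (\<forall>x. \<bar>f x\<bar> \<le> 1) \<longrightarrow>
        \<bar>(\<integral>y. f y \<partial>trans_kernel Px X t x) - (\<integral>y. f y \<partial>trans_kernel Px X t z)\<bar> \<le> \<epsilon>) at_top"
      if "x \<in> ball z \<delta>" for x
    proof -
      have "Limsup at_top (\<lambda>t. SUP f\<in>F. ereal \<bar>Pt Px X t f x - Pt Px X t f z\<bar>) < ereal \<epsilon>"
        by (rule le_less_trans[OF \<delta>(2)]) (use that \<epsilon> in \<open>auto simp: dist_commute\<close>)
      from Limsup_lessD[OF this] show ?thesis
      proof eventually_elim
        case (elim t)
        show ?case
        proof (intro ballI impI)
          fix f :: "'a \<Rightarrow> real" assume "f \<in> bounded_lipschitz" "\<forall>x. \<bar>f x\<bar> \<le> 1"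
          then have "f \<in> F" using F by auto
          then have "ereal \<bar>Pt Px X t f x - Pt Px X t f z\<bar> < ereal \<epsilon>"
            by (rule le_less_trans[OF SUP_upper[where f="\<lambda>f. ereal \<bar>Pt Px X t f x - Pt Px X t f z\<bar>"] elim])
          then show "\<bar>(\<integral>y. f y \<partial>trans_kernel Px X t x) - (\<integral>y. f y \<partial>trans_kernel Px X t z)\<bar> \<le> \<epsilon>"
            by (simp add: Pt_def)
        qed
      qed
    qed
    with \<delta>(1) show "\<exists>r>0. \<forall>x\<in>ball z r. eventually (\<lambda>t. \<forall>f\<in>bounded_lipschitz. (\<forall>x. \<bar>f x\<bar> \<le> 1) \<longrightarrow>
        \<bar>(\<integral>y. f y \<partial>trans_kernel Px X t x) - (\<integral>y. f y \<partial>trans_kernel Px X t z)\<bar> \<le> \<epsilon>) at_top"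
      by blast
  next
    fix r :: real assume "r > 0"
    then have "(INF x. Liminf at_top (\<lambda>t. emeasure (trans_kernel Px X t x) (ball z r))) > 0"
      using c1 by (simp add: cond_C1_def)
    \<comment> \<open>A level strictly between 0 and the infimum is finite and strictly below each
      lower limit, so it is eventually exceeded from every starting point.\<close>
    then obtain a where a: "0 < a" "a < (INF x. Liminf at_top (\<lambda>t. emeasure (trans_kernel Px X t x) (ball z r)))"
      using dense[of 0] by blast
    have "a < top" by (rule less_le_trans[OF a(2) top_greatest])
    then obtain \<alpha> where \<alpha>: "a = ennreal \<alpha>" "\<alpha> > 0"
      using a(1) by (cases a) auto
    have "eventually (\<lambda>t. \<alpha> \<le> measure (trans_kernel Px X t x) (ball z r)) at_top" for x
    proof -
      have "a < Liminf at_top (\<lambda>t. emeasure (trans_kernel Px X t x) (ball z r))"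
        using a(2) by (rule less_le_trans) (rule INF_lower, simp)
      from less_LiminfD[OF this] eventually_ge_at_top[of 0] show ?thesis
      proof eventually_elim
        case (elim t)
        interpret prob_space "trans_kernel Px X t x" by (rule prob_p) (rule elim)
        show ?case using elim \<alpha> by (simp add: emeasure_eq_measure ennreal_less_iff)
      qed
    qed
    with \<alpha>(2) show "\<exists>\<alpha>>0. \<forall>x. eventually (\<lambda>t. \<alpha> \<le> measure (trans_kernel Px X t x) (ball z r)) at_top"
      by blast
  qed
qed

lemma invariant_prob_iff_invariant_law:
  fixes Px :: "'a::polish_space \<Rightarrow> 'w measure"
  assumes "feller_kernels (trans_kernel Px X)"
  shows "invariant_prob Px X \<mu> \<longleftrightarrow> feller_kernels.invariant_law (trans_kernel Px X) \<mu>"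
proof -
  interpret feller_kernels "trans_kernel Px X" by fact
  have "(\<integral>\<^sup>+x. emeasure (trans_kernel Px X t x) A \<partial>\<mu>) = emeasure \<mu> A \<longleftrightarrow> law \<mu> t A = measure \<mu> A"
    if "prob_space \<mu>" "sets \<mu> = sets borel" "t \<ge> 0" "A \<in> sets borel" for t A
    using nn_integral_emeasure_p[OF that] law_bounds[OF that] that(1)
    by (simp add: finite_measure.emeasure_eq_measure prob_space_def)
  then show ?thesis
    unfolding invariant_prob_def invariant_measure_def invariant_law_def by auto
qed

text \<open>Take \<open>z\<close> in the support of the invariant law and a Lipschitz bump
  \<open>f\<close> below the indicator of \<open>ball z r\<close>. From every starting point the
  expectation of \<open>f\<close> tends to its integral \<open>c > 0\<close> under the invariant
  law, so \<open>c / 2\<close> is a lower bound independent of the starting point.\<close>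

lemma unif_asymp_stable_cond_C1:
  fixes Px :: "'a::polish_space \<Rightarrow> 'w measure"
  assumes "feller_kernels (trans_kernel Px X)" and F: "{f \<in> bounded_lipschitz. \<forall>x. \<bar>f x\<bar> \<le> 1} \<subseteq> F"
    and st: "unif_asymp_stable Px X F"
  shows "\<exists>z. cond_C1 Px X z"
proof -
  interpret feller_kernels "trans_kernel Px X" by fact
  obtain \<mu> where \<mu>: "invariant_prob Px X \<mu>" using st by (auto simp: unif_asymp_stable_def)
  then have m: "prob_space \<mu>" and sets_\<mu>: "sets \<mu> = sets borel"
    by (auto simp: invariant_prob_def invariant_measure_def)
  interpret \<mu>: prob_space \<mu> by (rule m)
  have space_\<mu>: "space \<mu> = UNIV" using sets_eq_imp_space_eq[OF sets_\<mu>] by simp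
  have conv: "eventually (\<lambda>t. \<forall>f\<in>F. \<bar>Pt Px X t f x - (\<integral>y. f y \<partial>\<mu>)\<bar> \<le> \<epsilon>) at_top" if "\<epsilon> > 0" for x \<epsilon>
    using st \<mu> that unfolding unif_asymp_stable_def by blast
  obtain z where z: "\<And>r. r > 0 \<Longrightarrow> measure \<mu> (ball z r) > 0"
    using prob_space_charges_balls[OF m sets_\<mu>] by blast
  have "(INF x. Liminf at_top (\<lambda>t. emeasure (trans_kernel Px X t x) (ball z r))) > 0" if r: "r > 0" for r
  proof -
    \<comment> \<open>Cutting off at 1 puts the bump into the unit ball of bounded Lipschitz
      functions, hence into \<open>F\<close>, for every radius \<open>r\<close>.\<close>
    define f where "f = (\<lambda>x. max 0 (min 1 (r - dist x z)))"
    have f: "0 \<le> f x" "f x \<le> indicator (ball z r) x" "\<bar>f x\<bar> \<le> 1" for x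
      by (auto simp: f_def indicator_def dist_commute)
    have "\<bar>f x - f y\<bar> \<le> 1 * dist x y" for x y
      using dist_triangle[of x z y] dist_triangle[of y z x] by (simp add: f_def dist_commute)
    moreover have "bounded (range f)" using f(3) by (intro boundedI[where B=1]) auto
    ultimately have "f \<in> bounded_lipschitz" unfolding bounded_lipschitz_def by blast
    then have fF: "f \<in> F" using F f(3) by auto
    have fm: "f \<in> borel_measurable borel"
      unfolding f_def by (intro borel_measurable_continuous_onI continuous_intros)
    have int: "integrable m f" if "prob_space m" "sets m = sets borel" for m
    proof -
      interpret prob_space m by fact
      have "f \<in> borel_measurable m" using fm that by (simp cong: measurable_cong_sets)
      then show ?thesis using f by (intro integrable_const_bound[where B=1]) auto
    qed
    define c where "c = (\<integral>y. f y \<partial>\<mu>)"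
    have c: "c > 0"
    proof (rule ccontr)
      assume "\<not> c > 0"
      moreover have "c \<ge> 0" unfolding c_def using f by (intro Bochner_Integration.integral_nonneg) auto
      ultimately have "AE x in \<mu>. f x = 0"
        unfolding c_def using integral_nonneg_eq_0_iff_AE[OF int[OF m sets_\<mu>]] f(1) by auto
      then have "AE x in \<mu>. x \<notin> ball z r" by eventually_elim (auto simp: f_def dist_commute)
      then have "emeasure \<mu> (ball z r) = 0"
        using AE_iff_measurable[of "ball z r" \<mu> "\<lambda>w. w \<notin> ball z r"] sets_\<mu> space_\<mu> by (auto simp: ball_def)
      with z[OF r] show False by (simp add: measure_def)
    qed
    have "ennreal (c / 2) \<le> Liminf at_top (\<lambda>t. emeasure (trans_kernel Px X t x) (ball z r))" for x
    proof (rule Liminf_bounded)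
      have "c / 2 > 0" using c by simp
      from conv[OF this, of x] eventually_ge_at_top[of 0]
      show "eventually (\<lambda>t. ennreal (c / 2) \<le> emeasure (trans_kernel Px X t x) (ball z r)) at_top"
      proof eventually_elim
        case (elim t)
        interpret P: prob_space "trans_kernel Px X t x" by (rule prob_p) (rule elim)
        have "\<bar>Pt Px X t f x - c\<bar> \<le> c / 2" using elim fF by (auto simp: c_def)
        then have "c / 2 \<le> Pt Px X t f x" by linarith
        also have "\<dots> \<le> (\<integral>y. indicator (ball z r) y \<partial>trans_kernel Px X t x)"
          unfolding Pt_def using f
          by (intro integral_mono int prob_p elim sets_p integrable_real_indicator) (auto simp: P.emeasure_eq_measure)
        finally have "c / 2 \<le> measure (trans_kernel Px X t x) (ball z r)" by simp
        then show ?case by (simp add: P.emeasure_eq_measure ennreal_leI)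
      qed
    qed
    then have "ennreal (c / 2) \<le> (INF x. Liminf at_top (\<lambda>t. emeasure (trans_kernel Px X t x) (ball z r)))"
      by (intro INF_greatest) auto
    moreover have "0 < ennreal (c / 2)" using c by simp
    ultimately show ?thesis by (rule less_le_trans[rotated])
  qed
  then show ?thesis unfolding cond_C1_def by blast
qed

text \<open>From all starting points the expectations converge, uniformly over \<open>F\<close>, to
  the same integrals. Hence any \<delta> will do, and 1 is taken.\<close>

lemma unif_asymp_stable_unif_ev_cont:
  fixes Px :: "'a::metric_space \<Rightarrow> 'w measure"
  assumes F: "F \<subseteq> classA Px X" and st: "unif_asymp_stable Px X F"
  shows "unif_ev_cont Px X F x"
proof -
  obtain \<mu> where \<mu>: "invariant_prob Px X \<mu>" using st by (auto simp: unif_asymp_stable_def)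
  have conv: "eventually (\<lambda>t. \<forall>f\<in>F. \<bar>Pt Px X t f x - (\<integral>y. f y \<partial>\<mu>)\<bar> \<le> \<epsilon>) at_top" if "\<epsilon> > 0" for x \<epsilon>
    using st \<mu> that unfolding unif_asymp_stable_def by blast
  have "Limsup at_top (\<lambda>t. SUP f\<in>F. ereal \<bar>Pt Px X t f x' - Pt Px X t f x\<bar>) \<le> ereal \<epsilon>" if "\<epsilon> > 0" for x' \<epsilon>
  proof (rule Limsup_bounded)
    have "\<epsilon> / 2 > 0" using that by simp
    from conv[OF this, of x] conv[OF this, of x']
    show "eventually (\<lambda>t. (SUP f\<in>F. ereal \<bar>Pt Px X t f x' - Pt Px X t f x\<bar>) \<le> ereal \<epsilon>) at_top"
    proof eventually_elim
      case (elim t)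
      show ?case
      proof (rule SUP_least)
        fix f assume "f \<in> F"
        with elim have "\<bar>Pt Px X t f x - (\<integral>y. f y \<partial>\<mu>)\<bar> \<le> \<epsilon> / 2" "\<bar>Pt Px X t f x' - (\<integral>y. f y \<partial>\<mu>)\<bar> \<le> \<epsilon> / 2"
          by auto
        then have "\<bar>Pt Px X t f x' - Pt Px X t f x\<bar> \<le> \<epsilon>" by linarith
        then show "ereal \<bar>Pt Px X t f x' - Pt Px X t f x\<bar> \<le> ereal \<epsilon>" by simp
      qed
    qed
  qed
  with F show ?thesis unfolding unif_ev_cont_def by (auto intro: exI[of _ 1])
qed

theorem mainTheorem4:
  fixes M :: "'w measure" and Px :: "'a::polish_space \<Rightarrow> 'w measure"
    and X :: "real \<Rightarrow> 'w \<Rightarrow> 'a" and F :: "('a \<Rightarrow> real) set"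
  assumes "cadlag_feller_markov M Px X"
    and "F \<subseteq> borel_measurable borel"
    and "{f \<in> bounded_lipschitz. \<forall>x. \<bar>f x\<bar> \<le> 1} \<subseteq> F"
    and "hyp_H2 M Px X F"
  shows "(unif_asymp_stable Px X F \<longleftrightarrow>
            ((\<forall>x. unif_ev_cont Px X F x) \<and> (\<exists>z. cond_C1 Px X z)))
       \<and> (((\<forall>x. unif_ev_cont Px X F x) \<and> (\<exists>z. cond_C1 Px X z)) \<longleftrightarrow>
            (\<exists>z. unif_ev_cont Px X F z \<and> cond_C1 Px X z))"
proof -
  have fk: "feller_kernels (trans_kernel Px X)"
    by (rule cadlag_feller_markov_feller_kernels) fact
  have "F \<noteq> {}" using assms(3) zero_in_unit_bounded_lipschitz by blast
  then obtain V where V: "V \<in> classA Px X" "\<And>y. 0 \<le> V y" "\<And>f y. f \<in> F \<Longrightarrow> \<bar>f y\<bar> \<le> V y"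
    and tail: "\<And>x \<epsilon>. \<epsilon> > 0 \<Longrightarrow> \<exists>K>0. \<forall>t\<ge>0.
      (\<integral>\<^sup>+y. ennreal (V y * indicator {y. K \<le> V y} y) \<partial>trans_kernel Px X t x) \<le> ennreal \<epsilon>"
    using hyp_H2_tail[OF assms(1,4)] by blast
  have Vm: "V \<in> borel_measurable borel" using V(1) by (simp add: classA_def)
  have FA: "F \<subseteq> classA Px X"
  proof
    fix f assume f: "f \<in> F"
    then have fm: "f \<in> borel_measurable borel" using assms(2) by auto
    have "integrable (trans_kernel Px X t x) f" if "t \<ge> 0" for t x
    proof (rule Bochner_Integration.integrable_bound)
      show "integrable (trans_kernel Px X t x) V" using V(1) that by (simp add: classA_def)
      show "f \<in> borel_measurable (trans_kernel Px X t x)" using fm by (simp add: trans_kernel_def)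
      show "AE y in trans_kernel Px X t x. norm (f y) \<le> norm (V y)" using V(2,3) f by simp
    qed
    with fm show "f \<in> classA Px X" by (simp add: classA_def)
  qed
  have stable: "unif_asymp_stable Px X F" if ec: "unif_ev_cont Px X F z" and c1: "cond_C1 Px X z" for z
  proof -
    interpret stable_kernels "trans_kernel Px X" z
      by (rule unif_ev_cont_cond_C1_stable_kernels[OF assms(1,3) ec c1])
    note inv = invariant_prob_iff_invariant_law[OF fk]
    have "integrable \<mu> f" if "invariant_law \<mu>" "f \<in> F" for \<mu> f
      by (rule uniformly_integrable_convergence(1)[of \<mu> V F]) (fact that Vm V tail assms)+
    moreover have "eventually (\<lambda>t. \<forall>f\<in>F. \<bar>Pt Px X t f x - (\<integral>y. f y \<partial>\<mu>)\<bar> \<le> \<epsilon>) at_top"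
      if "invariant_law \<mu>" "\<epsilon> > 0" for \<mu> x \<epsilon>
      unfolding Pt_def
      by (rule uniformly_integrable_convergence(2)[of \<mu> V F]) (fact that Vm V tail assms)+
    ultimately show ?thesis
      unfolding unif_asymp_stable_def inv using invariant_law_ex1 by auto
  qed
  \<comment> \<open>The cycle: (iii) gives (i) by \<open>stable\<close>; (i) gives eventual
    continuity everywhere and the lower bound somewhere, which is (ii); (ii) gives (iii) at the
    point of the lower bound.\<close>
  show ?thesis
    using stable unif_asymp_stable_unif_ev_cont[OF FA] unif_asymp_stable_cond_C1[OF fk assms(3)] by blast
qed

end
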